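(* Let $(\xi_k)_{k\in\mathbb{Z}}$ be a sequence of identically distributed martingale differences adapted to a filtration $(\mathcal{F}_k)_{k\in\mathbb{Z}}$, with $\mathbb{E}(\xi_0^2)=\infty$, such that $H_0(x)=\mathbb{E}(\xi_0^2I(|\xi_0|\le x))$ is slowly varying at $\infty$, and let $H$ be the modification of $H_0$ defined in the context. Let $(m_n)_{n\ge1}$ be positive integers and $(c_{nk})_{1\le k\le m_n}$, $n\ge1$, a triangular array of real numbers such that $$\sup_n\sum_{k=1}^{m_n}c_{nk}^2H(|c_{nk}|^{-1})<\infty\quad\text{and}\quad \max_{1\le k\le m_n}c_{nk}^2H(|c_{nk}|^{-1})\to0\ \text{ as } n\to\infty.$$ Assume that $\sum_{k=1}^{m_n}c_{nk}^2\xi_k^2\to1$ in probability as $n\to\infty$. Then $$\sum_{k=1}^{m_n}c_{nk}\xi_k\Rightarrow N(0,1)\quad\text{as } n\to\infty.$$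
   Context: $I(A)$ is the indicator of $A$; $\Rightarrow$ denotes convergence in distribution. Martingale differences adapted to $(\mathcal{F}_k)$: each $\xi_k$ is integrable, $\mathcal{F}_k$-measurable, and $\mathbb{E}(\xi_k\mid\mathcal{F}_{k-1})=0$ a.s. Set $H_0(x)=\mathbb{E}(\xi_0^2I(|\xi_0|\le x))$ for $x\ge 0$. Since $\mathbb{E}(\xi_0^2)=\infty$, $b=\inf\{x\ge0: H_0(x)>1\}$ is finite; define $H(x)=H_0(\max(x,b+1))$, so that $H(x)\ge 1$ for all $x\ge 0$ and $H(x)=H_0(x)$ for $x>b+1$. Convention: a term $c^2H(|c|^{-1})$ is interpreted as $0$ when $c=0$. A function $f$, positive for all large $x$, is slowly varying at $\infty$ if $f(tx)/f(x)\to1$ as $x\to\infty$ for every $t>0$. *)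

theory Defs
  imports "HOL-Probability.Probability"
begin

definition martingale_differences ::
  "'a measure \<Rightarrow> (int \<Rightarrow> 'a measure) \<Rightarrow> (int \<Rightarrow> 'a \<Rightarrow> real) \<Rightarrow> bool" where
  "martingale_differences M F \<xi> \<longleftrightarrow>
     filtration (space M) F \<and>
     (\<forall>k. subalgebra M (F k)) \<and>
     (\<forall>k. integrable M (\<xi> k)) \<and>
     (\<forall>k. \<xi> k \<in> borel_measurable (F k)) \<and>
     (\<forall>k. AE \<omega> in M. real_cond_exp M (F (k - 1)) (\<xi> k) \<omega> = 0)"

definition identically_distributed ::
  "'a measure \<Rightarrow> ('i \<Rightarrow> 'a \<Rightarrow> real) \<Rightarrow> bool" where
  "identically_distributed M X \<longleftrightarrow> (\<forall>i j. distr M borel (X i) = distr M borel (X j))"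

definition slowly_varying :: "(real \<Rightarrow> real) \<Rightarrow> bool" where
  "slowly_varying f \<longleftrightarrow>
     (\<forall>\<^sub>F x in at_top. f x > 0) \<and>
     (\<forall>t>0. ((\<lambda>x. f (t * x) / f x) \<longlongrightarrow> 1) at_top)"

definition trunc_moment :: "'a measure \<Rightarrow> ('a \<Rightarrow> real) \<Rightarrow> real \<Rightarrow> real" where
  "trunc_moment M X x = (\<integral>\<omega>. (X \<omega>)\<^sup>2 * indicator {\<omega>. \<bar>X \<omega>\<bar> \<le> x} \<omega> \<partial>M)"

text \<open>An infinite second moment of \<open>X\<close> makes the set below nonempty; the infimum of the
  empty set of reals is unspecified.\<close>

definition trunc_threshold :: "'a measure \<Rightarrow> ('a \<Rightarrow> real) \<Rightarrow> real" where
  "trunc_threshold M X = Inf {x. 0 \<le> x \<and> trunc_moment M X x > 1}"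

definition mod_trunc_moment :: "'a measure \<Rightarrow> ('a \<Rightarrow> real) \<Rightarrow> real \<Rightarrow> real" where
  "mod_trunc_moment M X x = trunc_moment M X (max x (trunc_threshold M X + 1))"

text \<open>The quantity \<open>c\<^sup>2 H(1/|c|)\<close>; the factor \<open>c\<^sup>2\<close> makes it \<open>0\<close> for \<open>c = 0\<close>,
  whatever the value of \<open>H\<close> at \<open>inverse 0\<close>.\<close>

definition weight :: "(real \<Rightarrow> real) \<Rightarrow> real \<Rightarrow> real" where
  "weight H c = c\<^sup>2 * H (inverse \<bar>c\<bar>)"

definition converges_in_probability ::
  "'a measure \<Rightarrow> (nat \<Rightarrow> 'a \<Rightarrow> real) \<Rightarrow> real \<Rightarrow> bool" where
  "converges_in_probability M X a \<longleftrightarrow>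
     (\<forall>\<epsilon>>0. (\<lambda>n. measure M {\<omega> \<in> space M. \<bar>X n \<omega> - a\<bar> > \<epsilon>}) \<longlonglongrightarrow> 0)"

end

theory Submission
  imports Defs
begin

text \<open>
  Karamata: slow variation of \<open>H\<^sub>0\<close> gives \<open>x E(|\<xi>|; |\<xi>| > x) = o(H\<^sub>0(x))\<close>. With the assumptions on the
  weights, the sum over \<open>k\<close> of \<open>E(|c \<xi>\<^sub>k|; |c \<xi>\<^sub>k| > \<epsilon>)\<close>, \<open>c = c\<^sub>n\<^sub>k\<close>, tends to \<open>0\<close> for every \<open>\<epsilon> > 0\<close>.
  Hence truncating \<open>c \<xi>\<^sub>k\<close> at \<open>1\<close> and recentering conditionally changes the sum by an amount that
  vanishes in \<open>L\<^sup>1\<close>; it leaves bounded martingale differences \<open>Y\<^sub>k\<close> that are uniformly small, with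
  sum of squares near \<open>1\<close>, off an event of small probability. McLeish's argument applies to these:
  \<open>T = \<Prod>k. (1 + \<i> t Y\<^sub>k)\<close>, with \<open>Y\<close> stopped once its squares add up to more than \<open>2\<close>, is bounded and
  has mean \<open>1\<close>, while \<open>exp (\<i> t \<Sum>k. Y\<^sub>k)\<close> is close to \<open>exp (- t\<^sup>2 / 2) T\<close> off that event.
\<close>

subsection \<open>Tail moments of slowly varying truncated second moments\<close>

text \<open>The strict inequality complements the \<open>\<le>\<close> in
  \<open>trunc_moment\<close>. A first moment is taken because it is finite for integrable X and
  controls both the L^1 error of truncation and, by Markov, the probability of large values.\<close>

definition tail_moment :: "'a measure \<Rightarrow> ('a \<Rightarrow> real) \<Rightarrow> real \<Rightarrow> real" where
  "tail_moment M X x = (\<integral>\<omega>. \<bar>X \<omega>\<bar> * indicator {\<omega>. x < \<bar>X \<omega>\<bar>} \<omega> \<partial>M)"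

context prob_space
begin

lemma integrable_trunc_moment [simp]:
  fixes X :: "'a \<Rightarrow> real"
  assumes [measurable]: "X \<in> borel_measurable M"
  shows "integrable M (\<lambda>\<omega>. (X \<omega>)\<^sup>2 * indicator {\<omega>. \<bar>X \<omega>\<bar> \<le> x} \<omega>)"
  by (rule integrable_const_bound[where B = "x\<^sup>2"])
     (auto split: split_indicator intro!: AE_I2 simp flip: abs_le_square_iff)

lemma trunc_moment_mono:
  assumes "X \<in> borel_measurable M" "x \<le> y"
  shows "trunc_moment M X x \<le> trunc_moment M X y"
  unfolding trunc_moment_def using assms
  by (intro integral_mono) (auto split: split_indicator)

lemma integrable_tail [simp]:
  fixes X :: "'a \<Rightarrow> real"
  assumes "integrable M X"
  shows "integrable M (\<lambda>\<omega>. \<bar>X \<omega>\<bar> * indicator {\<omega>. x < \<bar>X \<omega>\<bar>} \<omega>)"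
proof -
  have [measurable]: "X \<in> borel_measurable M" using assms by simp
  show ?thesis
    by (rule Bochner_Integration.integrable_bound[OF assms]) (auto split: split_indicator)
qed

lemma tail_moment_tendsto_0:
  assumes "integrable M X" and f: "filterlim f at_top sequentially"
  shows "(\<lambda>n. tail_moment M X (f n)) \<longlonglongrightarrow> 0"
proof -
  have [measurable]: "X \<in> borel_measurable M" using assms by simp
  have "(\<lambda>n. tail_moment M X (f n)) \<longlonglongrightarrow> (\<integral>\<omega>. 0 \<partial>M)"
    unfolding tail_moment_def
  proof (rule integral_dominated_convergence[where w = "\<lambda>\<omega>. \<bar>X \<omega>\<bar>"])
    show "AE \<omega> in M. (\<lambda>n. \<bar>X \<omega>\<bar> * indicator {\<omega>. f n < \<bar>X \<omega>\<bar>} \<omega>) \<longlonglongrightarrow> 0"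
    proof (intro AE_I2 tendsto_eventually)
      fix \<omega>
      have "eventually (\<lambda>n. \<bar>X \<omega>\<bar> \<le> f n) sequentially"
        using f by (simp add: filterlim_at_top)
      then show "eventually (\<lambda>n. \<bar>X \<omega>\<bar> * indicator {\<omega>. f n < \<bar>X \<omega>\<bar>} \<omega> = 0) sequentially"
        by eventually_elim auto
    qed
  qed (use assms in \<open>auto split: split_indicator\<close>)
  then show ?thesis by simp
qed

text \<open>On the event x < |X| \<le> 2x one has x|X| \<le> X^2, so this dyadic block is paid for
  by an increment of the truncated second moment.\<close>

lemma tail_moment_dyadic_step:
  assumes X: "integrable M X" and "0 \<le> x"
  shows "x * tail_moment M X x
    \<le> trunc_moment M X (2 * x) - trunc_moment M X x + x * tail_moment M X (2 * x)"
proof -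
  have [measurable]: "X \<in> borel_measurable M" using X by simp
  have pw: "x * (y * indicator {\<omega>. x < \<bar>X \<omega>\<bar>} \<omega>)
    \<le> y\<^sup>2 * indicator {\<omega>. \<bar>X \<omega>\<bar> \<le> 2 * x} \<omega> - y\<^sup>2 * indicator {\<omega>. \<bar>X \<omega>\<bar> \<le> x} \<omega>
      + x * (y * indicator {\<omega>. 2 * x < \<bar>X \<omega>\<bar>} \<omega>)" if "y = \<bar>X \<omega>\<bar>" for y \<omega>
  proof -
    have "x * y \<le> y * y" if "x < y"
      using that \<open>0 \<le> x\<close> by (intro mult_right_mono) auto
    then show ?thesis
      using \<open>0 \<le> x\<close> that by (auto split: split_indicator simp: power2_eq_square)
  qed
  have "x * tail_moment M X x = (\<integral>\<omega>. x * (\<bar>X \<omega>\<bar> * indicator {\<omega>. x < \<bar>X \<omega>\<bar>} \<omega>) \<partial>M)"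
    by (simp add: tail_moment_def)
  also have "\<dots> \<le> (\<integral>\<omega>. (X \<omega>)\<^sup>2 * indicator {\<omega>. \<bar>X \<omega>\<bar> \<le> 2 * x} \<omega>
      - (X \<omega>)\<^sup>2 * indicator {\<omega>. \<bar>X \<omega>\<bar> \<le> x} \<omega>
      + x * (\<bar>X \<omega>\<bar> * indicator {\<omega>. 2 * x < \<bar>X \<omega>\<bar>} \<omega>) \<partial>M)"
    using X pw[OF refl] by (intro integral_mono) auto
  also have "\<dots> = trunc_moment M X (2 * x) - trunc_moment M X x + x * tail_moment M X (2 * x)"
    using X by (simp add: tail_moment_def trunc_moment_def)
  finally show ?thesis .
qed

text \<open>The half of Karamata's theorem that is used: the dyadic step is iterated along x, 2x,
  4x, ..., with slow variation applied at the ratio 2.\<close>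

lemma tail_moment_le_trunc_moment:
  assumes X: "integrable M X" and sv: "slowly_varying (trunc_moment M X)" and "0 < \<delta>"
  shows "\<forall>\<^sub>F x in at_top. x * tail_moment M X x \<le> \<delta> * trunc_moment M X x"
proof -
  let ?H = "trunc_moment M X" and ?A = "tail_moment M X"
  \<comment> \<open>The quarter absorbs the factor 4 = 1 / (1 - 3/4) from summing the geometric
    series; the cap 1/2 keeps 1 + d below 3/2.\<close>
  define d where "d = min (\<delta> / 4) (1 / 2)"
  have d: "0 < d" "d \<le> 1 / 2" "4 * d \<le> \<delta>"
    using \<open>0 < \<delta>\<close> by (auto simp: d_def)
  have pos: "\<forall>\<^sub>F x in at_top. ?H x > 0"
    and ratio: "((\<lambda>x. ?H (2 * x) / ?H x) \<longlongrightarrow> 1) at_top"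
    using sv by (auto simp: slowly_varying_def)
  have "\<forall>\<^sub>F x in at_top. ?H (2 * x) / ?H x < 1 + d"
    by (rule order_tendstoD(2)[OF ratio]) (use d in simp)
  from this pos eventually_ge_at_top[of 1]
  have "\<forall>\<^sub>F x in at_top. ?H (2 * x) \<le> (1 + d) * ?H x \<and> 0 < ?H x \<and> 1 \<le> x"
    by eventually_elim (auto simp: field_simps)
  then obtain x0 where x0: "\<And>x. x0 \<le> x \<Longrightarrow> ?H (2 * x) \<le> (1 + d) * ?H x"
      "\<And>x. x0 \<le> x \<Longrightarrow> 0 < ?H x" "\<And>x. x0 \<le> x \<Longrightarrow> 1 \<le> x"
    by (auto simp: eventually_at_top_linorder)
  \<comment> \<open>each doubling of \<open>x\<close> halves the remainder, whereas \<open>H (2 * x) \<le> (3/2) * H x\<close>: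
    the error terms form a geometric series of ratio \<open>3/4\<close>\<close>
  have iter: "x * ?A x \<le> 4 * d * ?H x + x * ?A (2 ^ n * x)" if "x0 \<le> x" for n x
    using that
  proof (induction n arbitrary: x)
    case 0
    then show ?case using x0(2)[of x] d by simp
  next
    case (Suc n)
    have x: "1 \<le> x" "0 < ?H x" "?H (2 * x) \<le> (1 + d) * ?H x"
      using x0 Suc.prems by auto
    have "2 * x * ?A (2 * x) \<le> 4 * d * ?H (2 * x) + 2 * x * ?A (2 ^ n * (2 * x))"
      using Suc.IH[of "2 * x"] Suc.prems x by auto
    moreover have "4 * d * ?H (2 * x) \<le> 4 * d * ((3 / 2) * ?H x)"
    proof (intro mult_left_mono order_trans[OF x(3)] mult_right_mono)
    qed (use d x in auto)
    moreover have "?H (2 * x) - ?H x \<le> d * ?H x"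
      using x(3) by (simp add: algebra_simps)
    moreover have "x * ?A x \<le> ?H (2 * x) - ?H x + x * ?A (2 * x)"
      using X x by (intro tail_moment_dyadic_step) auto
    \<comment> \<open>The coefficients of \<open>?H x\<close> add up to d + (1/2) * 4d * (3/2) = 4d,
      so the constant 4d reproduces itself.\<close>
    ultimately show ?case
      by (simp add: mult_ac)
  qed
  \<comment> \<open>For fixed x the remainder vanishes as n grows, because X is integrable.\<close>
  have "x * ?A x \<le> 4 * d * ?H x" if "x0 \<le> x" for x
  proof (rule LIMSEQ_le_const)
    have "filterlim (\<lambda>n. 2 ^ n :: real) at_top sequentially"
      by (intro filterlim_at_infinity_imp_filterlim_at_top filterlim_realpow_sequentially_gt1) auto
    then have "filterlim (\<lambda>n. 2 ^ n * x) at_top sequentially"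
      using x0(3)[OF that]
      by (intro filterlim_at_top_mult_tendsto_pos[OF tendsto_const]) auto
    from tail_moment_tendsto_0[OF X this]
    have "(\<lambda>n. 4 * d * ?H x + x * ?A (2 ^ n * x)) \<longlonglongrightarrow> 4 * d * ?H x + x * 0"
      by (intro tendsto_intros)
    then show "(\<lambda>n. 4 * d * ?H x + x * ?A (2 ^ n * x)) \<longlonglongrightarrow> 4 * d * ?H x"
      by simp
    show "\<exists>N. \<forall>n\<ge>N. x * ?A x \<le> 4 * d * ?H x + x * ?A (2 ^ n * x)"
      using iter[OF that] by blast
  qed
  moreover have "4 * d * ?H x \<le> \<delta> * ?H x" if "x0 \<le> x" for x
    using d x0(2)[OF that] by (intro mult_right_mono) auto
  ultimately show ?thesis
    unfolding eventually_at_top_linorder by (meson order_trans)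
qed

text \<open>Markov's inequality restricted to the event itself, which lets the tail moment control
  large jumps.\<close>

lemma prob_gt_le_tail_moment:
  assumes X: "integrable M X" and "0 < x"
  shows "x * prob {\<omega> \<in> space M. x < \<bar>X \<omega>\<bar>} \<le> tail_moment M X x"
proof -
  have [measurable]: "X \<in> borel_measurable M" using X by simp
  have "x * prob {\<omega> \<in> space M. x < \<bar>X \<omega>\<bar>}
      = (\<integral>\<omega>. x * indicator {\<omega> \<in> space M. x < \<bar>X \<omega>\<bar>} \<omega> \<partial>M)"
    by simp
  also have "\<dots> \<le> tail_moment M X x"
    unfolding tail_moment_def using X \<open>0 < x\<close>
    by (intro integral_mono) (auto split: split_indicator simp: emeasure_eq_measure)
  finally show ?thesis .
qed

text \<open>Fatou along integer truncation levels: a uniform bound on the truncated moments would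
  bound the full second moment. This makes the set behind \<open>trunc_threshold\<close>
  nonempty.\<close>

lemma trunc_moment_unbounded:
  assumes [measurable]: "X \<in> borel_measurable M"
    and inf: "(\<integral>\<^sup>+\<omega>. ennreal ((X \<omega>)\<^sup>2) \<partial>M) = \<infinity>"
  shows "\<exists>x\<ge>0. C < trunc_moment M X x"
proof (rule ccontr)
  assume "\<not> ?thesis"
  then have le: "trunc_moment M X x \<le> C" if "0 \<le> x" for x
    using that by force
  have "(\<integral>\<^sup>+\<omega>. ennreal ((X \<omega>)\<^sup>2) \<partial>M)
      \<le> (\<integral>\<^sup>+\<omega>. liminf (\<lambda>n. ennreal ((X \<omega>)\<^sup>2 * indicator {\<omega>. \<bar>X \<omega>\<bar> \<le> real n} \<omega>)) \<partial>M)"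
  proof (intro nn_integral_mono Liminf_bounded)
    fix \<omega>
    obtain N :: nat where "\<bar>X \<omega>\<bar> \<le> real N"
      using real_arch_simple by blast
    then show "\<forall>\<^sub>F n in sequentially.
        ennreal ((X \<omega>)\<^sup>2) \<le> ennreal ((X \<omega>)\<^sup>2 * indicator {\<omega>. \<bar>X \<omega>\<bar> \<le> real n} \<omega>)"
      unfolding eventually_sequentially by (intro exI[of _ N]) auto
  qed
  also have "\<dots> \<le> liminf (\<lambda>n. \<integral>\<^sup>+\<omega>. ennreal ((X \<omega>)\<^sup>2 * indicator {\<omega>. \<bar>X \<omega>\<bar> \<le> real n} \<omega>) \<partial>M)"
    by (rule nn_integral_liminf) simp
  also have "\<dots> \<le> liminf (\<lambda>n::nat. ennreal C)"
  proof (intro Liminf_mono always_eventually allI)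
    fix n :: nat
    have "(\<integral>\<^sup>+\<omega>. ennreal ((X \<omega>)\<^sup>2 * indicator {\<omega>. \<bar>X \<omega>\<bar> \<le> real n} \<omega>) \<partial>M)
        = ennreal (trunc_moment M X (real n))"
      unfolding trunc_moment_def by (rule nn_integral_eq_integral) auto
    then show "(\<integral>\<^sup>+\<omega>. ennreal ((X \<omega>)\<^sup>2 * indicator {\<omega>. \<bar>X \<omega>\<bar> \<le> real n} \<omega>) \<partial>M) \<le> ennreal C"
      using le[of "real n"] by (simp add: ennreal_leI)
  qed
  also have "\<dots> = ennreal C"
    by (simp add: Liminf_const)
  finally have "(\<integral>\<^sup>+\<omega>. ennreal ((X \<omega>)\<^sup>2) \<partial>M) \<le> ennreal C" .
  then show False
    using inf by (simp add: top_unique)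
qed

end

section \<open>Row sums of tail moments under the conditions on the weights\<close>

context prob_space
begin

text \<open>Adding 1 to the infimum leaves room for a point y of the set strictly below it;
  monotonicity then transfers the bound at y. The first inequality yields c^2 \<le>
  \<open>weight\<close> of c, the second lets H replace H_0 in upper bounds.\<close>

lemma mod_trunc_moment_ge:
  assumes X: "X \<in> borel_measurable M" and inf: "(\<integral>\<^sup>+\<omega>. ennreal ((X \<omega>)\<^sup>2) \<partial>M) = \<infinity>"
  shows "1 \<le> mod_trunc_moment M X x" "trunc_moment M X x \<le> mod_trunc_moment M X x"
proof -
  let ?A = "{x. 0 \<le> x \<and> 1 < trunc_moment M X x}"
  have "?A \<noteq> {}"
    using trunc_moment_unbounded[OF X inf, of 1] by auto
  moreover have "bdd_below ?A"
    by (intro bdd_belowI[of _ 0]) auto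
  ultimately obtain y where y: "y \<in> ?A" "y < trunc_threshold M X + 1"
    using cInf_less_iff[of ?A "trunc_threshold M X + 1"] by (auto simp: trunc_threshold_def)
  have "1 \<le> trunc_moment M X y"
    using y by simp
  also have "\<dots> \<le> mod_trunc_moment M X x"
    unfolding mod_trunc_moment_def using y by (intro trunc_moment_mono X) simp
  finally show "1 \<le> mod_trunc_moment M X x" .
  show "trunc_moment M X x \<le> mod_trunc_moment M X x"
    unfolding mod_trunc_moment_def by (intro trunc_moment_mono X) simp
qed

text \<open>The Karamata bound at \<eta> / |c| turns each summand into a small multiple of the
  weight of c. The condition on the maximum makes it applicable to a whole row at once, and the
  bounded row sums finish the estimate.\<close>

lemma sum_tail_moment_tendsto_0:
  fixes a :: "nat \<Rightarrow> nat \<Rightarrow> real"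
  assumes X: "integrable M X" and inf: "(\<integral>\<^sup>+\<omega>. ennreal ((X \<omega>)\<^sup>2) \<partial>M) = \<infinity>"
    and sv: "slowly_varying (trunc_moment M X)"
    and sum: "\<forall>\<^sub>F n in sequentially. (\<Sum>k<m n. weight (mod_trunc_moment M X) (a n k)) \<le> B"
    and max: "\<And>\<delta>. 0 < \<delta> \<Longrightarrow>
      \<forall>\<^sub>F n in sequentially. \<forall>k<m n. weight (mod_trunc_moment M X) (a n k) < \<delta>"
    and \<eta>: "0 < \<eta>" "\<eta> \<le> 1"
  shows "(\<lambda>n. \<Sum>k<m n. \<bar>a n k\<bar> * tail_moment M X (\<eta> / \<bar>a n k\<bar>)) \<longlonglongrightarrow> 0"
proof (rule tendstoI)
  fix \<epsilon> :: real assume \<epsilon>: "0 < \<epsilon>"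
  let ?w = "weight (mod_trunc_moment M X)"
  have XM: "X \<in> borel_measurable M" using X by simp
  have tail0: "0 \<le> tail_moment M X x" for x
    unfolding tail_moment_def by (intro integral_nonneg_AE) auto
  \<comment> \<open>Chosen so that \<delta> / \<eta> * |B| < \<epsilon>; the added 1 avoids a zero
    denominator and makes the inequality strict.\<close>
  define \<delta> where "\<delta> = \<epsilon> * \<eta> / (\<bar>B\<bar> + 1)"
  have \<delta>: "0 < \<delta>" using \<epsilon> \<eta> by (auto simp: \<delta>_def)
  obtain x0 where x0: "0 < x0" "\<And>x. x0 \<le> x \<Longrightarrow> x * tail_moment M X x \<le> \<delta> * trunc_moment M X x"
  proof -
    obtain x1 where "\<And>x. x1 \<le> x \<Longrightarrow> x * tail_moment M X x \<le> \<delta> * trunc_moment M X x"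
      using tail_moment_le_trunc_moment[OF X sv \<delta>] by (auto simp: eventually_at_top_linorder)
    then show ?thesis
      using that[of "max x1 1"] by auto
  qed
  \<comment> \<open>Since H \<ge> 1, the bound on the weight forces |c| \<le> \<eta> / x0, so \<eta>
    / |c| lies in the range of the Karamata bound. For c = 0 both sides vanish.\<close>
  have row: "\<bar>c\<bar> * tail_moment M X (\<eta> / \<bar>c\<bar>) \<le> \<delta> / \<eta> * ?w c" if w: "?w c < (\<eta> / x0)\<^sup>2" for c
  proof (cases "c = 0")
    case False
    have "c\<^sup>2 * 1 \<le> ?w c"
      unfolding weight_def by (intro mult_left_mono mod_trunc_moment_ge[OF XM inf]) auto
    then have "\<bar>c\<bar>\<^sup>2 \<le> (\<eta> / x0)\<^sup>2" using w by simp
    then have "\<bar>c\<bar> \<le> \<eta> / x0"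
      by (rule power2_le_imp_le) (use \<eta> x0 in auto)
    then have "x0 \<le> \<eta> / \<bar>c\<bar>"
      using x0(1) False by (simp add: field_simps)
    then have "\<eta> / \<bar>c\<bar> * tail_moment M X (\<eta> / \<bar>c\<bar>) \<le> \<delta> * trunc_moment M X (\<eta> / \<bar>c\<bar>)"
      by (rule x0(2))
    \<comment> \<open>Here \<eta> \<le> 1 enters: the argument may be enlarged to 1 / |c|, where the
      weight evaluates H.\<close>
    also have "\<dots> \<le> \<delta> * trunc_moment M X (inverse \<bar>c\<bar>)"
      using \<delta> \<eta> False by (intro mult_left_mono trunc_moment_mono XM) (auto simp: divide_inverse mult_le_cancel_right1)
    also have "\<dots> \<le> \<delta> * mod_trunc_moment M X (inverse \<bar>c\<bar>)"
      using \<delta> by (intro mult_left_mono mod_trunc_moment_ge[OF XM inf]) auto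
    finally have le: "\<eta> / \<bar>c\<bar> * tail_moment M X (\<eta> / \<bar>c\<bar>)
        \<le> \<delta> * mod_trunc_moment M X (inverse \<bar>c\<bar>)" .
    have "\<bar>c\<bar> * y = c\<^sup>2 / \<eta> * (\<eta> / \<bar>c\<bar> * y)" for y
    proof -
      have "c\<^sup>2 / \<bar>c\<bar> = \<bar>c\<bar>"
        by (simp add: power2_eq_square abs_if)
      moreover have "c\<^sup>2 / \<eta> * (\<eta> / \<bar>c\<bar> * y) = c\<^sup>2 / \<bar>c\<bar> * y"
        using \<eta> by simp
      ultimately show ?thesis by simp
    qed
    then have "\<bar>c\<bar> * tail_moment M X (\<eta> / \<bar>c\<bar>)
        = c\<^sup>2 / \<eta> * (\<eta> / \<bar>c\<bar> * tail_moment M X (\<eta> / \<bar>c\<bar>))" .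
    also have "\<dots> \<le> c\<^sup>2 / \<eta> * (\<delta> * mod_trunc_moment M X (inverse \<bar>c\<bar>))"
      using \<eta> le by (intro mult_left_mono) auto
    also have "\<dots> = \<delta> / \<eta> * ?w c"
      by (simp add: weight_def)
    finally show ?thesis .
  qed (simp add: weight_def)
  have "0 < (\<eta> / x0)\<^sup>2" using \<eta> x0 by simp
  from max[OF this] sum
  show "\<forall>\<^sub>F n in sequentially. dist (\<Sum>k<m n. \<bar>a n k\<bar> * tail_moment M X (\<eta> / \<bar>a n k\<bar>)) 0 < \<epsilon>"
  proof eventually_elim
    case (elim n)
    have "(\<Sum>k<m n. \<bar>a n k\<bar> * tail_moment M X (\<eta> / \<bar>a n k\<bar>)) \<le> (\<Sum>k<m n. \<delta> / \<eta> * ?w (a n k))"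
      using elim row by (intro sum_mono) auto
    also have "\<dots> = \<delta> / \<eta> * (\<Sum>k<m n. ?w (a n k))"
      by (simp add: sum_distrib_left)
    also have "\<dots> \<le> \<delta> / \<eta> * \<bar>B\<bar>"
      using elim \<delta> \<eta> by (intro mult_left_mono) auto
    also have "\<dots> = \<epsilon> * (\<bar>B\<bar> / (\<bar>B\<bar> + 1))"
      using \<eta> by (simp add: \<delta>_def)
    also have "\<dots> < \<epsilon> * 1"
      using \<epsilon> by (intro mult_strict_left_mono) auto
    finally show ?case
      using tail0 by (simp add: sum_nonneg)
  qed
qed

lemma tail_moment_cmult:
  assumes "c \<noteq> 0"
  shows "tail_moment M (\<lambda>\<omega>. c * X \<omega>) x = \<bar>c\<bar> * tail_moment M X (x / \<bar>c\<bar>)"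
proof -
  have "(x < \<bar>c * y\<bar>) = (x / \<bar>c\<bar> < \<bar>y\<bar>)" for y
    using assms by (simp add: abs_mult field_simps)
  then show ?thesis
    unfolding tail_moment_def by (simp add: abs_mult mult.assoc)
qed

lemma prob_cmult_gt_le:
  assumes X: "integrable M X" and "0 < x"
  shows "prob {\<omega> \<in> space M. x < \<bar>c * X \<omega>\<bar>} \<le> \<bar>c\<bar> * tail_moment M X (x / \<bar>c\<bar>) / x"
\<comment> \<open>For c = 0 the event is empty because x > 0, and the factor |c| annihilates the
  right-hand side, whatever x / 0 means.\<close>
proof (cases "c = 0")
  case False
  have "x * prob {\<omega> \<in> space M. x < \<bar>c * X \<omega>\<bar>} \<le> tail_moment M (\<lambda>\<omega>. c * X \<omega>) x"
    using assms by (intro prob_gt_le_tail_moment) auto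
  then show ?thesis
    using \<open>0 < x\<close> False by (simp add: tail_moment_cmult field_simps)
qed (use assms in simp)

end

text \<open>The tail moment is an integral against the law; through this lemma identical
  distribution reduces every tail to that of one variable.\<close>

lemma tail_moment_cong_distr:
  assumes [measurable]: "X \<in> borel_measurable M" "Y \<in> borel_measurable M"
    and eq: "distr M borel X = distr M borel Y"
  shows "tail_moment M X = tail_moment M Y"
proof
  fix x :: real
  have "(\<integral>\<omega>. \<bar>Z \<omega>\<bar> * indicator {\<omega>. x < \<bar>Z \<omega>\<bar>} \<omega> \<partial>M)
      = (\<integral>y. \<bar>y\<bar> * indicator {y. x < \<bar>y\<bar>} y \<partial>distr M borel Z)"
    if [measurable]: "Z \<in> borel_measurable M" for Z
    by (subst integral_distr) (auto simp: indicator_def)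
  then show "tail_moment M X x = tail_moment M Y x"
    unfolding tail_moment_def using eq by simp
qed

subsection \<open>Martingale differences with bounded increments\<close>

lemma norm_one_plus_ix_le: "norm (1 + \<i> * complex_of_real x) \<le> exp (x\<^sup>2 / 2)"
proof -
  have "(norm (1 + \<i> * complex_of_real x))\<^sup>2 = 1 + x\<^sup>2"
    by (simp add: cmod_power2)
  also have "\<dots> \<le> exp (x\<^sup>2)"
    by (rule exp_ge_add_one_self)
  also have "\<dots> = (exp (x\<^sup>2 / 2))\<^sup>2"
    by (simp add: power2_eq_square flip: exp_add)
  finally show ?thesis
    by (rule power2_le_imp_le) simp
qed

text \<open>The difference of the two sides vanishes at 0 and has derivative exp(-x) - 1 + x \<ge>
  0.\<close>

lemma exp_minus_le_quadratic:
  fixes y :: real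
  assumes "0 \<le> y"
  shows "exp (- y) \<le> 1 - y + y\<^sup>2 / 2"
proof -
  have "1 - 0 + 0\<^sup>2 / 2 - exp (- 0) \<le> 1 - y + y\<^sup>2 / 2 - exp (- y)"
  proof (rule DERIV_nonneg_imp_nondecreasing[OF assms])
    fix x :: real
    show "\<exists>D. ((\<lambda>y. 1 - y + y\<^sup>2 / 2 - exp (- y)) has_real_derivative D) (at x) \<and> 0 \<le> D"
      using exp_ge_add_one_self[of "- x"]
      by (intro exI[of _ "- 1 + x + exp (- x)"]) (auto intro!: derivative_eq_intros)
  qed
  then show ?thesis by simp
qed

text \<open>For |x| \<le> 1 both terms agree with 1 + ix - x^2/2 up to third order. For |x| > 1 both
  have norm at most 1, which is where the constant 2 comes from.\<close>

lemma iexp_minus_gaussian_le: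
  "norm (iexp x - (1 + \<i> * complex_of_real x) * complex_of_real (exp (- x\<^sup>2 / 2))) \<le> 2 * \<bar>x\<bar> ^ 3"
proof (cases "\<bar>x\<bar> \<le> 1")
  case True
  define r where "r = exp (- x\<^sup>2 / 2) - (1 - x\<^sup>2 / 2)"
  have x2: "x\<^sup>2 \<le> 1"
    using True by (simp add: abs_square_le_1)
  have r: "0 \<le> r" "r \<le> x ^ 4 / 8"
    using exp_ge_add_one_self[of "- x\<^sup>2 / 2"] exp_minus_le_quadratic[of "x\<^sup>2 / 2"]
    by (auto simp: r_def power_divide)
  \<comment> \<open>The cubic term arises from ix times -x^2/2, and \<open>r\<close> is the
    first-order Taylor remainder of the Gaussian factor, at most x^4 / 8.\<close>
  have "iexp x - (1 + \<i> * of_real x) * of_real (exp (- x\<^sup>2 / 2))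
    = (iexp x - (\<Sum>k\<le>2. (\<i> * of_real x) ^ k / fact k)) + \<i> * of_real (x ^ 3 / 2)
      - (1 + \<i> * of_real x) * of_real r"
    by (simp add: r_def eval_nat_numeral algebra_simps)
  also have "norm \<dots> \<le> \<bar>x\<bar> ^ 3 / 6 + \<bar>x\<bar> ^ 3 / 2 + 2 * (\<bar>x\<bar> ^ 3 / 8)"
  proof (rule norm_triangle_le_diff[OF add_mono[OF norm_triangle_le[OF add_mono]]])
    show "norm (iexp x - (\<Sum>k\<le>2. (\<i> * of_real x) ^ k / fact k)) \<le> \<bar>x\<bar> ^ 3 / 6"
      using iexp_approx1[of x 2] by (simp add: fact_numeral eval_nat_numeral)
    show "norm (\<i> * complex_of_real (x ^ 3 / 2)) \<le> \<bar>x\<bar> ^ 3 / 2"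
      by (simp add: norm_mult norm_divide norm_power)
    have "x ^ 4 \<le> \<bar>x\<bar> ^ 3"
      using True power_decreasing[of 3 4 "\<bar>x\<bar>"] by simp
    moreover have "norm (1 + \<i> * complex_of_real x) \<le> 2"
      using True norm_triangle_ineq[of 1 "\<i> * complex_of_real x"] by (simp add: norm_mult)
    ultimately show "norm ((1 + \<i> * complex_of_real x) * of_real r) \<le> 2 * (\<bar>x\<bar> ^ 3 / 8)"
      using r unfolding norm_mult by (intro mult_mono) auto
  qed
  also have "\<dots> \<le> 2 * \<bar>x\<bar> ^ 3"
    by simp
  finally show ?thesis .
next
  case False
  have "norm ((1 + \<i> * complex_of_real x) * of_real (exp (- x\<^sup>2 / 2)))
      \<le> exp (x\<^sup>2 / 2) * exp (- x\<^sup>2 / 2)"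
    unfolding norm_mult by (intro mult_mono norm_one_plus_ix_le) auto
  then have "norm ((1 + \<i> * complex_of_real x) * of_real (exp (- x\<^sup>2 / 2))) \<le> 1"
    by (simp flip: exp_add)
  then have "norm (iexp x - (1 + \<i> * complex_of_real x) * complex_of_real (exp (- x\<^sup>2 / 2))) \<le> 2"
    using norm_triangle_ineq4[of "iexp x" "(1 + \<i> * of_real x) * of_real (exp (- x\<^sup>2 / 2))"]
    by simp
  moreover have "1 \<le> \<bar>x\<bar> ^ 3"
    using False by (intro one_le_power) simp
  ultimately show ?thesis by linarith
qed

text \<open>All factors of both products have norm at most 1, so the difference of the products is
  at most the sum of the differences of factors. The Gaussian factors collect into one exponential
  of the sum of squares.\<close>

lemma prod_iexp_minus_gaussian_le:
  assumes "finite I"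
  shows "norm (iexp (t * (\<Sum>k\<in>I. y k))
      - (\<Prod>k\<in>I. 1 + \<i> * complex_of_real (t * y k))
        * complex_of_real (exp (- t\<^sup>2 * (\<Sum>k\<in>I. (y k)\<^sup>2) / 2)))
    \<le> 2 * \<bar>t\<bar> ^ 3 * (\<Sum>k\<in>I. \<bar>y k\<bar> ^ 3)"
proof -
  let ?w = "\<lambda>x. (1 + \<i> * complex_of_real x) * complex_of_real (exp (- x\<^sup>2 / 2))"
  have 1: "iexp (t * (\<Sum>k\<in>I. y k)) = (\<Prod>k\<in>I. iexp (t * y k))"
    using assms by (simp add: sum_distrib_left exp_sum)
  have 2: "complex_of_real (exp (- t\<^sup>2 * (\<Sum>k\<in>I. (y k)\<^sup>2) / 2))
      = (\<Prod>k\<in>I. complex_of_real (exp (- (t * y k)\<^sup>2 / 2)))"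
    using assms
    by (simp add: power_mult_distrib sum_distrib_left sum_divide_distrib flip: exp_sum of_real_prod sum_negf)
  have w: "norm (?w x) \<le> 1" for x
  proof -
    have "norm (?w x) \<le> exp (x\<^sup>2 / 2) * exp (- x\<^sup>2 / 2)"
      unfolding norm_mult by (intro mult_mono norm_one_plus_ix_le) auto
    then show ?thesis by (simp flip: exp_add)
  qed
  have "norm ((\<Prod>k\<in>I. iexp (t * y k)) - (\<Prod>k\<in>I. ?w (t * y k)))
      \<le> (\<Sum>k\<in>I. norm (iexp (t * y k) - ?w (t * y k)))"
    by (intro norm_prod_diff w) auto
  also have "\<dots> \<le> (\<Sum>k\<in>I. 2 * \<bar>t * y k\<bar> ^ 3)"
    by (intro sum_mono iexp_minus_gaussian_le)
  also have "\<dots> = 2 * \<bar>t\<bar> ^ 3 * (\<Sum>k\<in>I. \<bar>y k\<bar> ^ 3)"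
    by (simp add: abs_mult power_mult_distrib sum_distrib_left mult_ac)
  finally show ?thesis
    unfolding 1 2 prod.distrib .
qed

section \<open>Products of martingale factors along a filtration\<close>

locale filtered_prob_space = prob_space M + filtration "space M" G
  for M :: "'a measure" and G :: "nat \<Rightarrow> 'a measure" +
  assumes subalgebra_G: "subalgebra M (G k)"
begin

lemma sigma_finite_subalgebra_G: "sigma_finite_subalgebra M (G k)"
proof -
  interpret finite_measure_subalgebra M "G k"
    by unfold_locales (rule subalgebra_G)
  show ?thesis
    by (rule sigma_finite_subalgebra_axioms)
qed

lemma measurable_G_M: "f \<in> borel_measurable (G k) \<Longrightarrow> f \<in> borel_measurable M"
  by (rule measurable_from_subalg[OF subalgebra_G])

lemma measurable_G_mono:
  assumes "f \<in> borel_measurable (G j)" "j \<le> k"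
  shows "f \<in> borel_measurable (G k)"
proof (rule measurable_from_subalg)
  show "subalgebra (G k) (G j)"
    using sets_F_mono[OF assms(2)] by (simp add: subalgebra_def space_F)
qed fact

text \<open>A bounded factor known at time k can be moved inside the conditional expectation. The
  real and imaginary parts are treated separately because \<open>real_cond_exp\<close> is
  real-valued.\<close>

lemma expectation_mult_eq_0:
  fixes g :: "'a \<Rightarrow> complex"
  assumes g: "g \<in> borel_measurable (G k)" "\<And>\<omega>. norm (g \<omega>) \<le> C"
    and Y: "integrable M Y" "AE \<omega> in M. real_cond_exp M (G k) Y \<omega> = 0"
  shows "integrable M (\<lambda>\<omega>. g \<omega> * complex_of_real (Y \<omega>))"
    and "(\<integral>\<omega>. g \<omega> * complex_of_real (Y \<omega>) \<partial>M) = 0"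
proof -
  interpret S: sigma_finite_subalgebra M "G k"
    by (rule sigma_finite_subalgebra_G)
  have [measurable]: "Y \<in> borel_measurable M" "g \<in> borel_measurable M"
    using Y(1) g(1) measurable_G_M by auto
  show int: "integrable M (\<lambda>\<omega>. g \<omega> * complex_of_real (Y \<omega>))"
  proof (rule Bochner_Integration.integrable_bound)
    show "integrable M (\<lambda>\<omega>. C * Y \<omega>)" using Y by simp
    have "norm (g \<omega>) \<le> \<bar>C\<bar>" for \<omega>
      using g(2)[of \<omega>] by linarith
    then show "AE \<omega> in M. norm (g \<omega> * complex_of_real (Y \<omega>)) \<le> norm (C * Y \<omega>)"
      by (auto simp: norm_mult abs_mult intro!: mult_right_mono)
  qed measurable
  have *: "(\<integral>\<omega>. h \<omega> * Y \<omega> \<partial>M) = 0"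
    if "h \<in> borel_measurable (G k)" "integrable M (\<lambda>\<omega>. h \<omega> * Y \<omega>)" for h
  proof -
    have [measurable]: "h \<in> borel_measurable M"
      using that measurable_G_M by auto
    have "(\<integral>\<omega>. h \<omega> * Y \<omega> \<partial>M) = (\<integral>\<omega>. h \<omega> * real_cond_exp M (G k) Y \<omega> \<partial>M)"
      using that by (intro S.real_cond_exp_intg(2)[symmetric]) auto
    also have "\<dots> = (\<integral>\<omega>. 0 \<partial>M)"
      using Y(2) by (intro integral_cong_AE) auto
    finally show ?thesis by simp
  qed
  have "integrable M (\<lambda>\<omega>. Re (g \<omega>) * Y \<omega>)" "integrable M (\<lambda>\<omega>. Im (g \<omega>) * Y \<omega>)"
    using integrable_Re[OF int] integrable_Im[OF int] by simp_all
  then show "(\<integral>\<omega>. g \<omega> * complex_of_real (Y \<omega>) \<partial>M) = 0"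
    using *[of "\<lambda>\<omega>. Re (g \<omega>)"] *[of "\<lambda>\<omega>. Im (g \<omega>)"] g(1)
      integral_Re[OF int] integral_Im[OF int]
    by (intro complex_eqI) (auto simp: measurable_compose[OF _ borel_measurable_Re] measurable_compose[OF _ borel_measurable_Im])
qed

text \<open>Each new factor adds it Y_n times the earlier product, a term of mean zero. In the
  indexing, \<open>G k\<close> is the past of the increment \<open>Y k\<close>, which is itself
  known at time \<open>Suc k\<close>.\<close>

lemma expectation_prod_one_plus_iY:
  assumes Y: "\<And>k. k < m \<Longrightarrow> Y k \<in> borel_measurable (G (Suc k))"
    and bound: "\<And>k \<omega>. k < m \<Longrightarrow> \<bar>Y k \<omega>\<bar> \<le> K"
    and mds: "\<And>k. k < m \<Longrightarrow> AE \<omega> in M. real_cond_exp M (G k) (Y k) \<omega> = 0"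
  shows "integrable M (\<lambda>\<omega>. \<Prod>k<m. 1 + \<i> * complex_of_real (t * Y k \<omega>))"
    and "(\<integral>\<omega>. (\<Prod>k<m. 1 + \<i> * complex_of_real (t * Y k \<omega>)) \<partial>M) = 1"
proof -
  let ?T = "\<lambda>n \<omega>. \<Prod>k<n. 1 + \<i> * complex_of_real (t * Y k \<omega>)"
  have "integrable M (?T n) \<and> (\<integral>\<omega>. ?T n \<omega> \<partial>M) = 1" if "n \<le> m" for n
    using that
  proof (induction n)
    case 0
    then show ?case by (simp add: prob_space)
  next
    case (Suc n)
    have meas: "?T n \<in> borel_measurable (G n)"
    proof (intro borel_measurable_prod)
      fix k assume "k \<in> {..<n}"
      then have [measurable]: "Y k \<in> borel_measurable (G n)"
        using Suc.prems measurable_G_mono[OF Y[of k], of n] by auto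
      show "(\<lambda>\<omega>. 1 + \<i> * complex_of_real (t * Y k \<omega>)) \<in> borel_measurable (G n)"
        by measurable
    qed
    \<comment> \<open>This bound grows with n and only secures integrability; a bound free of n
      comes later from stopping.\<close>
    have norm: "norm (?T n \<omega>) \<le> (1 + \<bar>t\<bar> * K) ^ n" for \<omega>
    proof -
      have "norm (?T n \<omega>) = (\<Prod>k<n. norm (1 + \<i> * complex_of_real (t * Y k \<omega>)))"
        by (simp add: prod_norm)
      also have "\<dots> \<le> (\<Prod>k<n. 1 + \<bar>t\<bar> * K)"
      proof (intro prod_mono conjI norm_ge_zero)
        fix k assume "k \<in> {..<n}"
        then have "\<bar>t\<bar> * \<bar>Y k \<omega>\<bar> \<le> \<bar>t\<bar> * K"
          using Suc.prems by (intro mult_left_mono bound) auto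
        then show "norm (1 + \<i> * complex_of_real (t * Y k \<omega>)) \<le> 1 + \<bar>t\<bar> * K"
          using norm_triangle_ineq[of 1 "\<i> * complex_of_real (t * Y k \<omega>)"]
          by (simp add: norm_mult)
      qed
      finally show ?thesis by simp
    qed
    have n: "n < m" using Suc.prems by simp
    have "Y n \<in> borel_measurable M"
      using Y[OF n] by (rule measurable_G_M)
    then have int: "integrable M (Y n)"
      using bound[OF n] by (intro integrable_const_bound[where B = K]) auto
    note * = expectation_mult_eq_0[OF meas norm int mds[OF n]]
    have eq: "?T (Suc n) = (\<lambda>\<omega>. ?T n \<omega> + (\<i> * complex_of_real t) * (?T n \<omega> * complex_of_real (Y n \<omega>)))"
      by (simp add: algebra_simps)
    have "integrable M (?T n)" "(\<integral>\<omega>. ?T n \<omega> \<partial>M) = 1"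
      using Suc.IH n by auto
    then show ?case
      unfolding eq using * by simp
  qed
  then show "integrable M (?T m)" "(\<integral>\<omega>. ?T m \<omega> \<partial>M) = 1"
    by auto
qed

end

text \<open>Stopping keeps the product of the factors \<open>1 + \<i> t Y\<^sub>k\<close> bounded, because the squares
  can exceed \<open>2\<close> only through the last jump before stopping.\<close>

definition stopped :: "(nat \<Rightarrow> 'a \<Rightarrow> real) \<Rightarrow> nat \<Rightarrow> 'a \<Rightarrow> real" where
  "stopped Y k \<omega> = (if (\<Sum>j<k. (Y j \<omega>)\<^sup>2) \<le> 2 then Y k \<omega> else 0)"

lemma stopped_eq:
  assumes "(\<Sum>j<m. (Y j \<omega>)\<^sup>2) \<le> 2" "k < m"
  shows "stopped Y k \<omega> = Y k \<omega>"
proof -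
  have "(\<Sum>j<k. (Y j \<omega>)\<^sup>2) \<le> (\<Sum>j<m. (Y j \<omega>)\<^sup>2)"
    using assms by (intro sum_mono2) auto
  then show ?thesis
    using assms by (simp add: stopped_def)
qed

text \<open>While the original sum stays at most 2, one further jump adds at most K^2; once it
  exceeds 2, all later stopped terms are 0.\<close>

lemma sum_stopped_squares_le:
  assumes "\<And>k. k < m \<Longrightarrow> \<bar>Y k \<omega>\<bar> \<le> K"
  shows "(\<Sum>k<m. (stopped Y k \<omega>)\<^sup>2) \<le> 2 + K\<^sup>2"
  using assms
proof (induction m)
  case (Suc m)
  show ?case
  proof (cases "(\<Sum>j<m. (Y j \<omega>)\<^sup>2) \<le> 2")
    case True
    have "(\<Sum>k<m. (stopped Y k \<omega>)\<^sup>2) \<le> (\<Sum>j<m. (Y j \<omega>)\<^sup>2)"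
      by (intro sum_mono) (auto simp: stopped_def)
    moreover have "\<bar>Y m \<omega>\<bar>\<^sup>2 \<le> K\<^sup>2"
      using Suc.prems by (intro power_mono) auto
    ultimately show ?thesis
      using True by (simp add: stopped_def)
  qed (use Suc in \<open>simp add: stopped_def\<close>)
qed simp

context filtered_prob_space
begin

text \<open>McLeish's comparison with exceptional event \<open>E\<close>. Off \<open>E\<close> the
  cubes are at most \<epsilon> times the squares, and replacing the random sum of squares by 1 costs
  a multiple of \<epsilon>. On \<open>E\<close> the uniform bound on the stopped product
  suffices.\<close>

lemma char_bounded_mds_le:
  assumes Y: "\<And>k. k < m \<Longrightarrow> Y k \<in> borel_measurable (G (Suc k))"
    and bound: "\<And>k \<omega>. k < m \<Longrightarrow> \<bar>Y k \<omega>\<bar> \<le> K"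
    and mds: "\<And>k. k < m \<Longrightarrow> AE \<omega> in M. real_cond_exp M (G k) (Y k) \<omega> = 0"
    and E: "E \<in> events" and \<epsilon>: "0 \<le> \<epsilon>" "\<epsilon> \<le> 1"
    and small: "\<And>k \<omega>. k < m \<Longrightarrow> \<omega> \<in> space M - E \<Longrightarrow> \<bar>Y k \<omega>\<bar> \<le> \<epsilon>"
    and squares: "\<And>\<omega>. \<omega> \<in> space M - E \<Longrightarrow> \<bar>(\<Sum>k<m. (Y k \<omega>)\<^sup>2) - 1\<bar> \<le> \<epsilon>"
  shows "norm ((\<integral>\<omega>. iexp (t * (\<Sum>k<m. Y k \<omega>)) \<partial>M) - complex_of_real (exp (- t\<^sup>2 / 2)))
    \<le> (4 * \<bar>t\<bar> ^ 3 + exp (t\<^sup>2 * (2 + K\<^sup>2) / 2) * t\<^sup>2) * \<epsilon>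
      + (1 + exp (t\<^sup>2 * (2 + K\<^sup>2) / 2)) * prob E"
proof -
  define Z where "Z = stopped Y"
  define T where "T = (\<lambda>\<omega>. \<Prod>k<m. 1 + \<i> * complex_of_real (t * Z k \<omega>))"
  define D where "D = exp (t\<^sup>2 * (2 + K\<^sup>2) / 2)"
  define g where "g = exp (- t\<^sup>2 / 2)"
  \<comment> \<open>Since T has mean 1, the expectation of R is exactly the quantity to be
    bounded.\<close>
  define R where "R = (\<lambda>\<omega>. iexp (t * (\<Sum>k<m. Y k \<omega>)) - complex_of_real g * T \<omega>)"
  have g: "0 \<le> g" "g \<le> 1" by (auto simp: g_def)
  have YM: "Y k \<in> borel_measurable M" if "k < m" for k
    using Y[OF that] by (rule measurable_G_M)
  have Zm: "Z k \<in> borel_measurable (G (Suc k))"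
    and Zmds: "AE \<omega> in M. real_cond_exp M (G k) (Z k) \<omega> = 0" if k: "k < m" for k
  proof -
    interpret S: sigma_finite_subalgebra M "G k"
      by (rule sigma_finite_subalgebra_G)
    \<comment> \<open>The stopping factor involves only the increments with j < k, so it is
      \<open>G k\<close>-measurable and stopping preserves the martingale property.\<close>
    define i where "i = (\<lambda>\<omega>. if (\<Sum>j<k. (Y j \<omega>)\<^sup>2) \<le> 2 then 1 else 0 :: real)"
    have Z: "Z k = (\<lambda>\<omega>. i \<omega> * Y k \<omega>)"
      by (auto simp: Z_def stopped_def i_def)
    have 1: "Y j \<in> borel_measurable (G k)" if "j < k" for j
      using measurable_G_mono[OF Y[of j], of k] that k by auto
    have s: "(\<lambda>\<omega>. \<Sum>j<k. (Y j \<omega>)\<^sup>2) \<in> borel_measurable (G k)"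
      using 1 by (intro borel_measurable_sum borel_measurable_power) auto
    have i: "i \<in> borel_measurable (G k)"
      using s unfolding i_def by measurable
    show "Z k \<in> borel_measurable (G (Suc k))"
      unfolding Z using measurable_G_mono[OF i, of "Suc k"] Y[OF k]
      by (intro borel_measurable_times) auto
    have "integrable M (\<lambda>\<omega>. i \<omega> * Y k \<omega>)"
      using measurable_G_M[OF i] YM[OF k] bound[OF k]
      by (intro integrable_const_bound[where B = "\<bar>K\<bar>"])
         (auto simp: i_def intro!: AE_I2 order_trans[OF bound[OF k]])
    from S.real_cond_exp_mult[OF i YM[OF k] this] mds[OF k]
    show "AE \<omega> in M. real_cond_exp M (G k) (Z k) \<omega> = 0"
      unfolding Z by eventually_elim simp
  qed
  have Zb: "\<bar>Z k \<omega>\<bar> \<le> K" if "k < m" for k \<omega>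
    using bound[OF that, of \<omega>] by (auto simp: Z_def stopped_def)
  have T: "integrable M T" "(\<integral>\<omega>. T \<omega> \<partial>M) = 1"
    unfolding T_def by (rule expectation_prod_one_plus_iY[where Y = Z, OF Zm Zb Zmds]; assumption)+
  have Tb: "norm (T \<omega>) \<le> D" for \<omega>
  proof -
    have "norm (T \<omega>) = (\<Prod>k<m. norm (1 + \<i> * complex_of_real (t * Z k \<omega>)))"
      unfolding T_def by (simp add: prod_norm)
    also have "\<dots> \<le> (\<Prod>k<m. exp ((t * Z k \<omega>)\<^sup>2 / 2))"
      by (intro prod_mono conjI norm_ge_zero norm_one_plus_ix_le)
    also have "\<dots> = exp (t\<^sup>2 * (\<Sum>k<m. (Z k \<omega>)\<^sup>2) / 2)"
      by (simp add: exp_sum sum_distrib_left sum_divide_distrib power_mult_distrib)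
    also have "\<dots> \<le> D"
      unfolding D_def Z_def using sum_stopped_squares_le[where m = m and Y = Y, OF bound]
      by (auto intro!: divide_right_mono mult_left_mono)
    finally show ?thesis .
  qed
  have S: "(\<lambda>\<omega>. \<Sum>k<m. Y k \<omega>) \<in> borel_measurable M"
    using YM by (intro borel_measurable_sum) auto
  have iexp_int: "integrable M (\<lambda>\<omega>. iexp (t * (\<Sum>k<m. Y k \<omega>)))"
    using S by (intro integrable_const_bound[where B = 1]) (auto simp del: of_real_sum)
  have R: "integrable M R"
    unfolding R_def using iexp_int T by auto
  have R_bad: "norm (R \<omega>) \<le> 1 + D" for \<omega>
  proof -
    have "norm (complex_of_real g * T \<omega>) \<le> 1 * D"
      using g Tb[of \<omega>] unfolding norm_mult by (intro mult_mono) auto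
    then show ?thesis
      unfolding R_def
      using norm_triangle_ineq4[of "iexp (t * (\<Sum>k<m. Y k \<omega>))" "complex_of_real g * T \<omega>"]
      by simp
  qed
  have R_good: "norm (R \<omega>) \<le> (4 * \<bar>t\<bar> ^ 3 + D * t\<^sup>2) * \<epsilon>" if \<omega>: "\<omega> \<in> space M - E" for \<omega>
  proof -
    define V where "V = (\<Sum>k<m. (Y k \<omega>)\<^sup>2)"
    have V: "\<bar>V - 1\<bar> \<le> \<epsilon>" "0 \<le> V"
      using squares[OF \<omega>] by (auto simp: V_def intro: sum_nonneg)
    \<comment> \<open>Because \<epsilon> \<le> 1, no stopping has occurred at this \<omega>, and T
      is the product of the original factors.\<close>
    then have V2: "V \<le> 2" using \<epsilon> by linarith
    have T_eq: "T \<omega> = (\<Prod>k<m. 1 + \<i> * complex_of_real (t * Y k \<omega>))"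
      unfolding T_def Z_def using stopped_eq[of Y \<omega> m] V2 by (simp add: V_def)
    have "(\<Sum>k<m. \<bar>Y k \<omega>\<bar> ^ 3) \<le> (\<Sum>k<m. \<epsilon> * (Y k \<omega>)\<^sup>2)"
    proof (intro sum_mono)
      fix k assume "k \<in> {..<m}"
      then have "\<bar>Y k \<omega>\<bar> * (Y k \<omega>)\<^sup>2 \<le> \<epsilon> * (Y k \<omega>)\<^sup>2"
        using small[of k \<omega>] \<omega> by (intro mult_right_mono) auto
      moreover have "\<bar>Y k \<omega>\<bar> ^ 3 = \<bar>Y k \<omega>\<bar> * (Y k \<omega>)\<^sup>2"
        by (simp add: power3_eq_cube power2_eq_square abs_mult flip: mult.assoc)
      ultimately show "\<bar>Y k \<omega>\<bar> ^ 3 \<le> \<epsilon> * (Y k \<omega>)\<^sup>2" by simp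
    qed
    also have "\<dots> = \<epsilon> * V" by (simp add: V_def sum_distrib_left)
    also have "\<dots> \<le> \<epsilon> * 2" using V2 \<epsilon> by (intro mult_left_mono) auto
    finally have cubes: "(\<Sum>k<m. \<bar>Y k \<omega>\<bar> ^ 3) \<le> \<epsilon> * 2" .
    have "norm (iexp (t * (\<Sum>k<m. Y k \<omega>)) - T \<omega> * complex_of_real (exp (- t\<^sup>2 * V / 2)))
        \<le> 2 * \<bar>t\<bar> ^ 3 * (\<Sum>k<m. \<bar>Y k \<omega>\<bar> ^ 3)"
      unfolding T_eq V_def by (rule prod_iexp_minus_gaussian_le) simp
    also have "\<dots> \<le> 2 * \<bar>t\<bar> ^ 3 * (\<epsilon> * 2)"
      by (intro mult_left_mono cubes) auto
    finally have 1: "norm (iexp (t * (\<Sum>k<m. Y k \<omega>)) - T \<omega> * complex_of_real (exp (- t\<^sup>2 * V / 2)))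
        \<le> 4 * \<bar>t\<bar> ^ 3 * \<epsilon>" by simp
    \<comment> \<open>The map a \<mapsto> exp(-a) is 1-Lipschitz on the nonnegative reals.\<close>
    have lip: "exp (- a) - exp (- b) \<le> b - a" if "0 \<le> a" "a \<le> b" for a b :: real
    proof -
      have "exp (- a) * (1 - exp (a - b)) \<le> 1 * (b - a)"
      proof (intro mult_mono)
        show "1 - exp (a - b) \<le> b - a"
          using exp_ge_add_one_self[of "a - b"] by linarith
      qed (use that in auto)
      then show ?thesis by (simp add: algebra_simps flip: exp_add)
    qed
    have "\<bar>exp (- (t\<^sup>2 * V / 2)) - exp (- (t\<^sup>2 / 2))\<bar> \<le> \<bar>t\<^sup>2 * V / 2 - t\<^sup>2 / 2\<bar>"
      using lip[of "t\<^sup>2 * V / 2" "t\<^sup>2 / 2"] lip[of "t\<^sup>2 / 2" "t\<^sup>2 * V / 2"] V(2)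
      by (cases "t\<^sup>2 * V / 2 \<le> t\<^sup>2 / 2") (auto simp: abs_if)
    also have "t\<^sup>2 * V / 2 - t\<^sup>2 / 2 = t\<^sup>2 / 2 * (V - 1)"
      by (simp add: field_simps)
    also have "\<bar>t\<^sup>2 / 2 * (V - 1)\<bar> = t\<^sup>2 / 2 * \<bar>V - 1\<bar>"
      by (simp add: abs_mult)
    also have "\<dots> \<le> t\<^sup>2 * \<epsilon>"
      using V(1) by (intro mult_mono) auto
    finally have "norm (complex_of_real (exp (- t\<^sup>2 * V / 2)) - complex_of_real g) \<le> t\<^sup>2 * \<epsilon>"
      unfolding g_def of_real_diff[symmetric] norm_of_real by simp
    then have 2: "norm (T \<omega> * (complex_of_real (exp (- t\<^sup>2 * V / 2)) - complex_of_real g)) \<le> D * (t\<^sup>2 * \<epsilon>)"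
      unfolding norm_mult by (intro mult_mono Tb) (auto simp: D_def)
    have "R \<omega> = (iexp (t * (\<Sum>k<m. Y k \<omega>)) - T \<omega> * complex_of_real (exp (- t\<^sup>2 * V / 2)))
        + T \<omega> * (complex_of_real (exp (- t\<^sup>2 * V / 2)) - complex_of_real g)"
      by (simp add: R_def algebra_simps)
    also have "norm \<dots> \<le> 4 * \<bar>t\<bar> ^ 3 * \<epsilon> + D * (t\<^sup>2 * \<epsilon>)"
      by (rule norm_triangle_le[OF add_mono[OF 1 2]])
    finally show ?thesis by (simp add: algebra_simps)
  qed
  have c0: "0 \<le> (4 * \<bar>t\<bar> ^ 3 + D * t\<^sup>2) * \<epsilon>"
    using \<epsilon> by (auto simp: D_def)
  have "(\<integral>\<omega>. iexp (t * (\<Sum>k<m. Y k \<omega>)) \<partial>M) - complex_of_real g = (\<integral>\<omega>. R \<omega> \<partial>M)"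
    unfolding R_def using iexp_int T by simp
  also have "norm \<dots> \<le> (\<integral>\<omega>. norm (R \<omega>) \<partial>M)"
    by (rule integral_norm_bound)
  also have "\<dots> \<le> (\<integral>\<omega>. (4 * \<bar>t\<bar> ^ 3 + D * t\<^sup>2) * \<epsilon> + (1 + D) * indicator E \<omega> \<partial>M)"
  proof (rule integral_mono)
    show "norm (R \<omega>) \<le> (4 * \<bar>t\<bar> ^ 3 + D * t\<^sup>2) * \<epsilon> + (1 + D) * indicator E \<omega>"
      if "\<omega> \<in> space M" for \<omega>
      using R_bad[of \<omega>] R_good[of \<omega>] c0 that by (cases "\<omega> \<in> E") auto
  qed (use R E in \<open>auto simp: emeasure_eq_measure\<close>)
  also have "\<dots> = (4 * \<bar>t\<bar> ^ 3 + D * t\<^sup>2) * \<epsilon> + (1 + D) * prob E"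
    using E by (simp add: prob_space emeasure_eq_measure)
  finally show ?thesis
    by (simp add: g_def D_def)
qed

end

subsection \<open>Truncation and the central limit theorem for arrays\<close>

text \<open>L^1 contraction, obtained by testing against the sign of the conditional expectation,
  which is bounded and measurable for the smaller \<sigma>-algebra.\<close>

lemma (in sigma_finite_subalgebra) integral_abs_real_cond_exp_le:
  assumes f: "integrable M f"
  shows "(\<integral>x. \<bar>real_cond_exp M F f x\<bar> \<partial>M) \<le> (\<integral>x. \<bar>f x\<bar> \<partial>M)"
proof -
  let ?s = "\<lambda>x. sgn (real_cond_exp M F f x)"
  have [measurable]: "f \<in> borel_measurable M" using f by simp
  have s: "?s \<in> borel_measurable F" by measurable
  then have [measurable]: "?s \<in> borel_measurable M"
    by (rule measurable_from_subalg[OF subalg])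
  have sf: "integrable M (\<lambda>x. ?s x * f x)"
    by (rule Bochner_Integration.integrable_bound[OF f])
       (auto simp: abs_mult abs_sgn_eq intro!: AE_I2)
  have "(\<integral>x. \<bar>real_cond_exp M F f x\<bar> \<partial>M) = (\<integral>x. ?s x * real_cond_exp M F f x \<partial>M)"
    by (simp add: abs_sgn mult.commute)
  also have "\<dots> = (\<integral>x. ?s x * f x \<partial>M)"
    by (rule real_cond_exp_intg(2)[OF sf s]) simp
  also have "\<dots> \<le> (\<integral>x. \<bar>f x\<bar> \<partial>M)"
    using f sf by (intro integral_mono) (auto simp: sgn_if)
  finally show ?thesis .
qed

lemma norm_iexp_diff_le: "norm (iexp x - iexp y) \<le> \<bar>x - y\<bar>"
proof -
  have "iexp x - iexp y = iexp y * (iexp (x - y) - 1)"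
    by (simp add: algebra_simps flip: exp_add)
  also have "norm \<dots> = norm (iexp (x - y) - 1)"
    by (simp add: norm_mult)
  also have "\<dots> \<le> \<bar>x - y\<bar>"
    using iexp_approx1[of "x - y" 0] by simp
  finally show ?thesis .
qed

context filtered_prob_space
begin

text \<open>Truncation at 1 and conditional recentering reduce to
  \<open>char_bounded_mds_le\<close>. The tail moments enter twice: divided by \<eta> in the
  probability of the exceptional event, and times 2|t| in the cost of exchanging the sums.\<close>

lemma char_mds_le:
  assumes X: "\<And>k. k < m \<Longrightarrow> X k \<in> borel_measurable (G (Suc k))"
    and int: "\<And>k. k < m \<Longrightarrow> integrable M (X k)"
    and mds: "\<And>k. k < m \<Longrightarrow> AE \<omega> in M. real_cond_exp M (G k) (X k) \<omega> = 0"
    and \<eta>: "0 < \<eta>" "\<eta> \<le> 1 / 4"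
  shows "norm ((\<integral>\<omega>. iexp (t * (\<Sum>k<m. X k \<omega>)) \<partial>M) - complex_of_real (exp (- t\<^sup>2 / 2)))
    \<le> (4 * \<bar>t\<bar> ^ 3 + exp (3 * t\<^sup>2) * t\<^sup>2) * (4 * \<eta>)
      + (1 + exp (3 * t\<^sup>2))
        * ((\<Sum>k<m. prob {\<omega> \<in> space M. \<eta> < \<bar>X k \<omega>\<bar>})
           + prob {\<omega> \<in> space M. \<bar>(\<Sum>k<m. (X k \<omega>)\<^sup>2) - 1\<bar> > \<eta>}
           + (\<Sum>k<m. tail_moment M (X k) 1) / \<eta>)
      + 2 * \<bar>t\<bar> * (\<Sum>k<m. tail_moment M (X k) 1)"
proof -
  define U where "U = (\<lambda>k \<omega>. X k \<omega> * indicator {\<omega>. \<bar>X k \<omega>\<bar> \<le> 1} \<omega>)"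
  define e where "e = (\<lambda>k \<omega>. max (- 1) (min 1 (real_cond_exp M (G k) (U k) \<omega>)))"
  \<comment> \<open>clipping changes the conditional expectation only on a null set, and makes \<open>Y\<close> bounded everywhere\<close>
  define Y where "Y = (\<lambda>k \<omega>. U k \<omega> - e k \<omega>)"
  define \<tau> where "\<tau> = (\<Sum>k<m. tail_moment M (X k) 1)"
  have XM: "X k \<in> borel_measurable M" if "k < m" for k
    using int[OF that] by simp
  have U_le: "\<bar>U k \<omega>\<bar> \<le> 1" for k \<omega>
    by (auto simp: U_def split: split_indicator)
  have e_le: "\<bar>e k \<omega>\<bar> \<le> 1" for k \<omega>
    by (auto simp: e_def)
  have XU: "\<bar>X k \<omega> - U k \<omega>\<bar> = \<bar>X k \<omega>\<bar> * indicator {\<omega>. 1 < \<bar>X k \<omega>\<bar>} \<omega>" for k \<omega>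
    by (auto simp: U_def split: split_indicator)
  have eG: "e k \<in> borel_measurable (G k)" for k
    unfolding e_def by measurable
  then have eM: "e k \<in> borel_measurable M" for k
    using measurable_G_M by blast
  have UG: "U k \<in> borel_measurable (G (Suc k))" if "k < m" for k
    using X[OF that] unfolding U_def by measurable
  have Uint: "integrable M (U k)" if "k < m" for k
    using measurable_G_M[OF UG[OF that]] U_le by (intro integrable_const_bound[where B = 1]) auto
  have eint: "integrable M (e k)" for k
    using eM e_le by (intro integrable_const_bound[where B = 1]) auto
  have e_eq: "AE \<omega> in M. e k \<omega> = real_cond_exp M (G k) (U k) \<omega>"
    and e_tail: "(\<integral>\<omega>. \<bar>e k \<omega>\<bar> \<partial>M) \<le> tail_moment M (X k) 1"
    and Ymds: "AE \<omega> in M. real_cond_exp M (G k) (Y k) \<omega> = 0" if k: "k < m" for k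
  proof -
    interpret S: sigma_finite_subalgebra M "G k"
      by (rule sigma_finite_subalgebra_G)
    \<comment> \<open>The conditional expectation of a variable in [-1, 1] lies in [-1, 1] almost
      surely, so clipping is harmless.\<close>
    have "AE \<omega> in M. - 1 \<le> U k \<omega>" "AE \<omega> in M. U k \<omega> \<le> 1"
      using U_le[of k] by (auto simp: abs_le_iff minus_le_iff)
    from S.real_cond_exp_ge_c[OF Uint[OF k] this(1)] S.real_cond_exp_le_c[OF Uint[OF k] this(2)]
    show e_eq: "AE \<omega> in M. e k \<omega> = real_cond_exp M (G k) (U k) \<omega>"
      by eventually_elim (simp add: e_def)
    \<comment> \<open>As X has conditional mean 0, that of U is minus that of the discarded part X -
      U; hence the centering is controlled by the tail.\<close>
    have "AE \<omega> in M. \<bar>e k \<omega>\<bar> = \<bar>real_cond_exp M (G k) (\<lambda>\<omega>. X k \<omega> - U k \<omega>) \<omega>\<bar>"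
      using S.real_cond_exp_diff[OF int[OF k] Uint[OF k]] e_eq mds[OF k]
      by eventually_elim simp
    then have "(\<integral>\<omega>. \<bar>e k \<omega>\<bar> \<partial>M) = (\<integral>\<omega>. \<bar>real_cond_exp M (G k) (\<lambda>\<omega>. X k \<omega> - U k \<omega>) \<omega>\<bar> \<partial>M)"
      using eM by (intro integral_cong_AE) auto
    also have "\<dots> \<le> (\<integral>\<omega>. \<bar>X k \<omega> - U k \<omega>\<bar> \<partial>M)"
      using int[OF k] Uint[OF k] by (intro S.integral_abs_real_cond_exp_le) auto
    also have "\<dots> = tail_moment M (X k) 1"
      by (simp add: XU tail_moment_def)
    finally show "(\<integral>\<omega>. \<bar>e k \<omega>\<bar> \<partial>M) \<le> tail_moment M (X k) 1" .
    show "AE \<omega> in M. real_cond_exp M (G k) (Y k) \<omega> = 0"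
      using S.real_cond_exp_diff[OF Uint[OF k] eint[of k]] S.real_cond_exp_F_meas[OF eint[of k] eG] e_eq
      unfolding Y_def by eventually_elim simp
  qed
  have Y: "Y k \<in> borel_measurable (G (Suc k))" if "k < m" for k
    unfolding Y_def using UG[OF that] measurable_G_mono[OF eG, of k "Suc k"]
    by (intro borel_measurable_diff) auto
  have Yb: "\<bar>Y k \<omega>\<bar> \<le> 2" for k \<omega>
    using U_le[of k \<omega>] e_le[of k \<omega>] unfolding Y_def by linarith
  \<comment> \<open>The three ways to fail: a jump above \<eta>, a sum of squares away from 1, a
    total recentering of at least \<eta>.\<close>
  define E1 where "E1 = (\<Union>k<m. {\<omega> \<in> space M. \<eta> < \<bar>X k \<omega>\<bar>})"
  define E2 where "E2 = {\<omega> \<in> space M. \<bar>(\<Sum>k<m. (X k \<omega>)\<^sup>2) - 1\<bar> > \<eta>}"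
  define E3 where "E3 = {\<omega> \<in> space M. \<eta> \<le> (\<Sum>k<m. \<bar>e k \<omega>\<bar>)}"
  have sets_gt: "{\<omega> \<in> space M. \<eta> < \<bar>X k \<omega>\<bar>} \<in> events" if "k < m" for k
    using XM[OF that] by measurable
  have sq: "(\<lambda>\<omega>. \<Sum>k<m. (X k \<omega>)\<^sup>2) \<in> borel_measurable M"
    using XM by (intro borel_measurable_sum borel_measurable_power) auto
  have E1: "E1 \<in> events"
    unfolding E1_def using sets_gt by (intro sets.finite_UN) auto
  have E2: "E2 \<in> events"
    unfolding E2_def using sq by measurable
  have E3: "E3 \<in> events"
    unfolding E3_def using eM by measurable
  have "prob E1 \<le> (\<Sum>k<m. prob {\<omega> \<in> space M. \<eta> < \<bar>X k \<omega>\<bar>})"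
    unfolding E1_def using sets_gt by (intro finite_measure_subadditive_finite) auto
  moreover have "prob E3 \<le> \<tau> / \<eta>"
  proof -
    have "prob E3 \<le> (\<integral>\<omega>. (\<Sum>k<m. \<bar>e k \<omega>\<bar>) \<partial>M) / \<eta>"
      unfolding E3_def using eint \<eta>
      by (intro integral_Markov_inequality_measure[where A = "{}"]) (auto intro!: AE_I2 sum_nonneg)
    also have "(\<integral>\<omega>. (\<Sum>k<m. \<bar>e k \<omega>\<bar>) \<partial>M) = (\<Sum>k<m. \<integral>\<omega>. \<bar>e k \<omega>\<bar> \<partial>M)"
      using eint by (intro Bochner_Integration.integral_sum) auto
    also have "(\<Sum>k<m. \<integral>\<omega>. \<bar>e k \<omega>\<bar> \<partial>M) / \<eta> \<le> \<tau> / \<eta>"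
      unfolding \<tau>_def using e_tail \<eta> by (intro divide_right_mono sum_mono) auto
    finally show ?thesis .
  qed
  moreover have "prob (E1 \<union> E2 \<union> E3) \<le> prob E1 + prob E2 + prob E3"
    using E1 E2 E3 measure_Un_le[of E1 M E2] measure_Un_le[of "E1 \<union> E2" M E3] by force
  ultimately have prob_bad: "prob (E1 \<union> E2 \<union> E3)
    \<le> (\<Sum>k<m. prob {\<omega> \<in> space M. \<eta> < \<bar>X k \<omega>\<bar>}) + prob E2 + \<tau> / \<eta>"
    by linarith
  \<comment> \<open>The 4\<eta> is 3\<eta> from recentering the squares plus \<eta> from E2; it also
    covers |Y| \<le> 2\<eta>. The assumption \<eta> \<le> 1/4 keeps it at most 1.\<close>
  have good: "(\<forall>k<m. \<bar>Y k \<omega>\<bar> \<le> 4 * \<eta>) \<and> \<bar>(\<Sum>k<m. (Y k \<omega>)\<^sup>2) - 1\<bar> \<le> 4 * \<eta>"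
    if \<omega>: "\<omega> \<in> space M - (E1 \<union> E2 \<union> E3)" for \<omega>
  proof (intro conjI allI impI)
    have X_le: "\<bar>X k \<omega>\<bar> \<le> \<eta>" if "k < m" for k
      using \<omega> that by (force simp: E1_def)
    then have UX: "U k \<omega> = X k \<omega>" if "k < m" for k
      using \<eta> that by (force simp: U_def)
    have sum_e: "(\<Sum>k<m. \<bar>e k \<omega>\<bar>) \<le> \<eta>"
      using \<omega> by (auto simp: E3_def)
    have "\<bar>e k \<omega>\<bar> \<le> \<eta>" if "k < m" for k
      using member_le_sum[of k "{..<m}" "\<lambda>k. \<bar>e k \<omega>\<bar>"] sum_e that by simp
    then show "\<bar>Y k \<omega>\<bar> \<le> 4 * \<eta>" if "k < m" for k
      using X_le[OF that] UX[OF that] \<eta> that by (force simp: Y_def)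
    have "\<bar>(\<Sum>k<m. (Y k \<omega>)\<^sup>2) - (\<Sum>k<m. (X k \<omega>)\<^sup>2)\<bar> \<le> (\<Sum>k<m. \<bar>(Y k \<omega>)\<^sup>2 - (X k \<omega>)\<^sup>2\<bar>)"
      by (simp flip: sum_subtractf)
    also have "\<dots> \<le> (\<Sum>k<m. 3 * \<bar>e k \<omega>\<bar>)"
    proof (intro sum_mono)
      fix k assume "k \<in> {..<m}"
      then have "(Y k \<omega>)\<^sup>2 - (X k \<omega>)\<^sup>2 = (e k \<omega> - 2 * U k \<omega>) * e k \<omega>"
        using UX[of k] by (simp add: Y_def power2_eq_square algebra_simps)
      moreover have "\<bar>e k \<omega> - 2 * U k \<omega>\<bar> \<le> 3"
        using e_le[of k \<omega>] U_le[of k \<omega>] by linarith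
      ultimately show "\<bar>(Y k \<omega>)\<^sup>2 - (X k \<omega>)\<^sup>2\<bar> \<le> 3 * \<bar>e k \<omega>\<bar>"
        by (simp add: abs_mult mult_right_mono)
    qed
    also have "\<dots> \<le> 3 * \<eta>"
      using sum_e by (simp flip: sum_distrib_left)
    finally have "\<bar>(\<Sum>k<m. (Y k \<omega>)\<^sup>2) - (\<Sum>k<m. (X k \<omega>)\<^sup>2)\<bar> \<le> 3 * \<eta>" .
    moreover have "\<bar>(\<Sum>k<m. (X k \<omega>)\<^sup>2) - 1\<bar> \<le> \<eta>"
      using \<omega> by (auto simp: E2_def)
    ultimately show "\<bar>(\<Sum>k<m. (Y k \<omega>)\<^sup>2) - 1\<bar> \<le> 4 * \<eta>"
      by linarith
  qed
  \<comment> \<open>With |Y| \<le> 2 the stopped squares add up to at most 2 + 2^2 = 6, whence the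
    exponent 3t^2.\<close>
  have charY: "norm ((\<integral>\<omega>. iexp (t * (\<Sum>k<m. Y k \<omega>)) \<partial>M) - complex_of_real (exp (- t\<^sup>2 / 2)))
    \<le> (4 * \<bar>t\<bar> ^ 3 + exp (t\<^sup>2 * (2 + 2\<^sup>2) / 2) * t\<^sup>2) * (4 * \<eta>)
      + (1 + exp (t\<^sup>2 * (2 + 2\<^sup>2) / 2)) * prob (E1 \<union> E2 \<union> E3)"
    using E1 E2 E3 \<eta> good
    by (intro char_bounded_mds_le[where Y = Y] Y Yb Ymds) auto
  also have "t\<^sup>2 * (2 + 2\<^sup>2) / 2 = 3 * t\<^sup>2"
    by simp
  also have "(1 + exp (3 * t\<^sup>2)) * prob (E1 \<union> E2 \<union> E3) \<le> (1 + exp (3 * t\<^sup>2)) *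
      ((\<Sum>k<m. prob {\<omega> \<in> space M. \<eta> < \<bar>X k \<omega>\<bar>}) + prob E2 + \<tau> / \<eta>)"
    using prob_bad by (intro mult_left_mono) (auto intro: add_nonneg_nonneg)
  finally have charY: "norm ((\<integral>\<omega>. iexp (t * (\<Sum>k<m. Y k \<omega>)) \<partial>M) - complex_of_real (exp (- t\<^sup>2 / 2)))
    \<le> (4 * \<bar>t\<bar> ^ 3 + exp (3 * t\<^sup>2) * t\<^sup>2) * (4 * \<eta>) + (1 + exp (3 * t\<^sup>2)) *
      ((\<Sum>k<m. prob {\<omega> \<in> space M. \<eta> < \<bar>X k \<omega>\<bar>}) + prob E2 + \<tau> / \<eta>)"
    by simp
  have iexp_int: "integrable M (\<lambda>\<omega>. iexp (t * (\<Sum>k<m. Z k \<omega>)))"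
    if "\<And>k. k < m \<Longrightarrow> Z k \<in> borel_measurable M" for Z
  proof -
    have "(\<lambda>\<omega>. \<Sum>k<m. Z k \<omega>) \<in> borel_measurable M"
      using that by (intro borel_measurable_sum) auto
    then show ?thesis
      by (intro integrable_const_bound[where B = 1]) (auto simp del: of_real_sum)
  qed
  have intX: "integrable M (\<lambda>\<omega>. iexp (t * (\<Sum>k<m. X k \<omega>)))"
    by (rule iexp_int[OF XM])
  have intY: "integrable M (\<lambda>\<omega>. iexp (t * (\<Sum>k<m. Y k \<omega>)))"
    by (rule iexp_int[OF measurable_G_M[OF Y]])
  have "norm ((\<integral>\<omega>. iexp (t * (\<Sum>k<m. X k \<omega>)) \<partial>M) - (\<integral>\<omega>. iexp (t * (\<Sum>k<m. Y k \<omega>)) \<partial>M))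
      = norm (\<integral>\<omega>. iexp (t * (\<Sum>k<m. X k \<omega>)) - iexp (t * (\<Sum>k<m. Y k \<omega>)) \<partial>M)"
    by (subst Bochner_Integration.integral_diff[OF intX intY]) (rule refl)
  also have "\<dots> \<le> (\<integral>\<omega>. norm (iexp (t * (\<Sum>k<m. X k \<omega>)) - iexp (t * (\<Sum>k<m. Y k \<omega>))) \<partial>M)"
    by (rule integral_norm_bound)
  \<comment> \<open>X - Y splits into the discarded part X - U and the centering e, each with L^1
    norm at most the tail moment.\<close>
  also have "\<dots> \<le> (\<integral>\<omega>. \<bar>t\<bar> * (\<Sum>k<m. \<bar>X k \<omega> - U k \<omega>\<bar> + \<bar>e k \<omega>\<bar>) \<partial>M)"
  proof (rule integral_mono)
    show "integrable M (\<lambda>\<omega>. norm (iexp (t * (\<Sum>k<m. X k \<omega>)) - iexp (t * (\<Sum>k<m. Y k \<omega>))))"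
      by (intro integrable_norm Bochner_Integration.integrable_diff intX intY)
    show "integrable M (\<lambda>\<omega>. \<bar>t\<bar> * (\<Sum>k<m. \<bar>X k \<omega> - U k \<omega>\<bar> + \<bar>e k \<omega>\<bar>))"
      using int Uint eint
      by (intro integrable_mult_right Bochner_Integration.integrable_sum Bochner_Integration.integrable_add
          integrable_abs Bochner_Integration.integrable_diff) auto
    fix \<omega>
    have "norm (iexp (t * (\<Sum>k<m. X k \<omega>)) - iexp (t * (\<Sum>k<m. Y k \<omega>)))
        \<le> \<bar>t * (\<Sum>k<m. X k \<omega>) - t * (\<Sum>k<m. Y k \<omega>)\<bar>"
      by (rule norm_iexp_diff_le)
    also have "\<dots> = \<bar>t\<bar> * \<bar>\<Sum>k<m. X k \<omega> - Y k \<omega>\<bar>"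
      by (simp add: sum_subtractf abs_mult flip: right_diff_distrib)
    also have "\<bar>\<Sum>k<m. X k \<omega> - Y k \<omega>\<bar> \<le> (\<Sum>k<m. \<bar>X k \<omega> - U k \<omega>\<bar> + \<bar>e k \<omega>\<bar>)"
      by (rule order_trans[OF sum_abs sum_mono]) (simp add: Y_def)
    finally show "norm (iexp (t * (\<Sum>k<m. X k \<omega>)) - iexp (t * (\<Sum>k<m. Y k \<omega>)))
        \<le> \<bar>t\<bar> * (\<Sum>k<m. \<bar>X k \<omega> - U k \<omega>\<bar> + \<bar>e k \<omega>\<bar>)"
      by (simp add: mult_left_mono)
  qed
  also have "\<dots> = \<bar>t\<bar> * (\<Sum>k<m. (\<integral>\<omega>. \<bar>X k \<omega> - U k \<omega>\<bar> \<partial>M) + (\<integral>\<omega>. \<bar>e k \<omega>\<bar> \<partial>M))"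
    using int Uint eint by (simp add: Bochner_Integration.integral_sum)
  also have "\<dots> \<le> \<bar>t\<bar> * (\<Sum>k<m. tail_moment M (X k) 1 + tail_moment M (X k) 1)"
    using e_tail by (intro mult_left_mono sum_mono add_mono) (auto simp: XU tail_moment_def)
  also have "\<dots> = 2 * \<bar>t\<bar> * \<tau>"
    by (simp add: \<tau>_def flip: sum_distrib_left)
  finally have "norm ((\<integral>\<omega>. iexp (t * (\<Sum>k<m. X k \<omega>)) \<partial>M) - (\<integral>\<omega>. iexp (t * (\<Sum>k<m. Y k \<omega>)) \<partial>M))
    \<le> 2 * \<bar>t\<bar> * \<tau>" .
  from norm_triangle_le[OF add_mono[OF this charY]] show ?thesis
    by (simp add: \<tau>_def E2_def)
qed

end

text \<open>Levy continuity applied to \<open>char_mds_le\<close>: for fixed \<eta> let n grow, then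
  take \<eta> small. The filtration may vary from row to row.\<close>

theorem martingale_array_clt:
  fixes X :: "nat \<Rightarrow> nat \<Rightarrow> 'a \<Rightarrow> real"
  assumes filt: "\<And>n. filtered_prob_space M (G n)"
    and X: "\<And>n k. k < m n \<Longrightarrow> X n k \<in> borel_measurable (G n (Suc k))"
    and int: "\<And>n k. k < m n \<Longrightarrow> integrable M (X n k)"
    and mds: "\<And>n k. k < m n \<Longrightarrow> AE \<omega> in M. real_cond_exp M (G n k) (X n k) \<omega> = 0"
    and small: "\<And>\<eta>. 0 < \<eta> \<Longrightarrow> (\<lambda>n. \<Sum>k<m n. measure M {\<omega> \<in> space M. \<eta> < \<bar>X n k \<omega>\<bar>}) \<longlonglongrightarrow> 0"
    and tail: "(\<lambda>n. \<Sum>k<m n. tail_moment M (X n k) 1) \<longlonglongrightarrow> 0"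
    and squares: "converges_in_probability M (\<lambda>n \<omega>. \<Sum>k<m n. (X n k \<omega>)\<^sup>2) 1"
  shows "weak_conv_m (\<lambda>n. distr M borel (\<lambda>\<omega>. \<Sum>k<m n. X n k \<omega>)) std_normal_distribution"
proof (rule levy_continuity)
  interpret prob_space M
    using filt[of 0] by (simp add: filtered_prob_space_def)
  have S: "(\<lambda>\<omega>. \<Sum>k<m n. X n k \<omega>) \<in> borel_measurable M" for n
    using int by (intro borel_measurable_sum) auto
  show "real_distribution (distr M borel (\<lambda>\<omega>. \<Sum>k<m n. X n k \<omega>))" for n
    using S by (rule real_distribution_distr)
  show "real_distribution std_normal_distribution"
    by (rule real_dist_normal_dist)
  fix t :: real
  define C where "C = 4 * \<bar>t\<bar> ^ 3 + exp (3 * t\<^sup>2) * t\<^sup>2"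
  have C: "0 \<le> C" by (simp add: C_def)
  \<comment> \<open>These are the terms of the bound that vanish as n grows with \<eta> fixed; what
    remains is C * (4\<eta>).\<close>
  define r where "r = (\<lambda>\<eta> n. (1 + exp (3 * t\<^sup>2))
        * ((\<Sum>k<m n. prob {\<omega> \<in> space M. \<eta> < \<bar>X n k \<omega>\<bar>})
           + prob {\<omega> \<in> space M. \<bar>(\<Sum>k<m n. (X n k \<omega>)\<^sup>2) - 1\<bar> > \<eta>}
           + (\<Sum>k<m n. tail_moment M (X n k) 1) / \<eta>)
      + 2 * \<bar>t\<bar> * (\<Sum>k<m n. tail_moment M (X n k) 1))"
  have r: "r \<eta> \<longlonglongrightarrow> 0" if "0 < \<eta>" for \<eta>
  proof -
    have "(\<lambda>n. prob {\<omega> \<in> space M. \<bar>(\<Sum>k<m n. (X n k \<omega>)\<^sup>2) - 1\<bar> > \<eta>}) \<longlonglongrightarrow> 0"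
      using squares that by (simp add: converges_in_probability_def)
    then have "r \<eta> \<longlonglongrightarrow> (1 + exp (3 * t\<^sup>2)) * (0 + 0 + 0 / \<eta>) + 2 * \<bar>t\<bar> * 0"
      unfolding r_def using that by (intro tendsto_intros small tail) auto
    then show ?thesis by simp
  qed
  have le: "norm (char (distr M borel (\<lambda>\<omega>. \<Sum>k<m n. X n k \<omega>)) t - char std_normal_distribution t)
      \<le> C * (4 * \<eta>) + r \<eta> n" if "0 < \<eta>" "\<eta> \<le> 1 / 4" for \<eta> n
  proof -
    interpret filtered_prob_space M "G n" by (rule filt)
    have "char (distr M borel (\<lambda>\<omega>. \<Sum>k<m n. X n k \<omega>)) t = (\<integral>\<omega>. iexp (t * (\<Sum>k<m n. X n k \<omega>)) \<partial>M)"
      unfolding char_def using S by (subst integral_distr) auto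
    then show ?thesis
      using char_mds_le[where m = "m n" and X = "X n", OF X int mds that, of t]
      by (simp add: char_std_normal_distribution r_def C_def add.assoc)
  qed
  show "(\<lambda>n. char (distr M borel (\<lambda>\<omega>. \<Sum>k<m n. X n k \<omega>)) t) \<longlonglongrightarrow> char std_normal_distribution t"
  proof (rule tendstoI)
    fix \<epsilon> :: real assume "0 < \<epsilon>"
    \<comment> \<open>The cap 1/4 is required by \<open>char_mds_le\<close>; the other term makes C
      * (4\<eta>) at most \<epsilon> / 2, with C + 1 guarding against C = 0.\<close>
    define \<eta> where "\<eta> = min (1 / 4) (\<epsilon> / (8 * (C + 1)))"
    have \<eta>: "0 < \<eta>" "\<eta> \<le> 1 / 4"
      unfolding \<eta>_def using \<open>0 < \<epsilon>\<close> C by (simp_all only: min.cobounded1) simp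
    have "\<eta> \<le> \<epsilon> / (8 * (C + 1))"
      unfolding \<eta>_def by (rule min.cobounded2)
    then have "C * (4 * \<eta>) \<le> (C + 1) * (4 * (\<epsilon> / (8 * (C + 1))))"
      using C \<eta> by (intro mult_mono) auto
    also have "\<dots> = \<epsilon> / 2"
      using C by (simp add: field_simps)
    finally have half: "C * (4 * \<eta>) \<le> \<epsilon> / 2" .
    have "\<forall>\<^sub>F n in sequentially. r \<eta> n < \<epsilon> / 2"
      by (rule order_tendstoD(2)[OF r[OF \<eta>(1)]]) (use \<open>0 < \<epsilon>\<close> in simp)
    then show "\<forall>\<^sub>F n in sequentially.
        dist (char (distr M borel (\<lambda>\<omega>. \<Sum>k<m n. X n k \<omega>)) t) (char std_normal_distribution t) < \<epsilon>"
    proof eventually_elim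
      case (elim n)
      then show ?case
        using le[OF \<eta>, of n] half unfolding dist_norm by linarith
    qed
  qed
qed

section \<open>Application to weighted identically distributed martingale differences\<close>

theorem theorem2p1:
  fixes M :: "'a measure"
    and F :: "int \<Rightarrow> 'a measure"
    and \<xi> :: "int \<Rightarrow> 'a \<Rightarrow> real"
    and m :: "nat \<Rightarrow> nat"
    and c :: "nat \<Rightarrow> nat \<Rightarrow> real"
  assumes "prob_space M"
    and "martingale_differences M F \<xi>"
    and "identically_distributed M \<xi>"
    and "(\<integral>\<^sup>+\<omega>. ennreal ((\<xi> 0 \<omega>)\<^sup>2) \<partial>M) = \<infinity>"
    and "slowly_varying (trunc_moment M (\<xi> 0))"
    and "\<And>n. n \<ge> 1 \<Longrightarrow> m n \<ge> 1"
    and "bdd_above ((\<lambda>n. \<Sum>k=1..m n. weight (mod_trunc_moment M (\<xi> 0)) (c n k)) ` {1..})"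
    and "(\<lambda>n. Max ((\<lambda>k. weight (mod_trunc_moment M (\<xi> 0)) (c n k)) ` {1..m n})) \<longlonglongrightarrow> 0"
    and "converges_in_probability M (\<lambda>n \<omega>. \<Sum>k=1..m n. (c n k)\<^sup>2 * (\<xi> (int k) \<omega>)\<^sup>2) 1"
  shows "weak_conv_m (\<lambda>n. distr M borel (\<lambda>\<omega>. \<Sum>k=1..m n. c n k * \<xi> (int k) \<omega>))
           std_normal_distribution"
proof -
  interpret prob_space M by fact
  let ?w = "weight (mod_trunc_moment M (\<xi> 0))"
  have filt: "filtration (space M) F" and sub: "\<And>k. subalgebra M (F k)"
    and int: "\<And>k. integrable M (\<xi> k)" and meas: "\<And>k. \<xi> k \<in> borel_measurable (F k)"
    and mds: "\<And>k. AE \<omega> in M. real_cond_exp M (F (k - 1)) (\<xi> k) \<omega> = 0"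
    using assms(2) by (auto simp: martingale_differences_def)
  interpret F: filtration "space M" F by fact
  \<comment> \<open>Only times from 0 on matter. Columns are shifted by one, so that
    \<open>F (int k)\<close> is the past of the term with index \<open>Suc k\<close>.\<close>
  interpret FN: filtered_prob_space M "\<lambda>k. F (int k)"
    by unfold_locales (auto intro!: F.sets_F_mono[THEN subsetD] sub simp: F.space_F)
  have tail_eq: "tail_moment M (\<xi> k) = tail_moment M (\<xi> 0)" for k
    using int assms(3) unfolding identically_distributed_def
    by (intro tail_moment_cong_distr) auto
  obtain B where B: "\<And>n. 1 \<le> n \<Longrightarrow> (\<Sum>k=1..m n. ?w (c n k)) \<le> B"
    using assms(7) by (auto simp: bdd_above_def)
  \<comment> \<open>The bound is given for rows n \<ge> 1, hence the eventual form.\<close>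
  have sum: "\<forall>\<^sub>F n in sequentially. (\<Sum>k<m n. ?w (c n (Suc k))) \<le> B"
    using eventually_ge_at_top[of 1]
    by eventually_elim (use B in \<open>simp add: sum.atLeast1_atMost_eq\<close>)
  have max: "\<forall>\<^sub>F n in sequentially. \<forall>k<m n. ?w (c n (Suc k)) < \<delta>" if "0 < \<delta>" for \<delta>
    using order_tendstoD(2)[OF assms(8) that]
  proof eventually_elim
    case (elim n)
    show ?case
    proof (intro allI impI)
      fix k assume "k < m n"
      then have "?w (c n (Suc k)) \<le> Max ((\<lambda>k. ?w (c n k)) ` {1..m n})"
        by (intro Max_ge) auto
      then show "?w (c n (Suc k)) < \<delta>"
        using elim by simp
    qed
  qed
  note lim = sum_tail_moment_tendsto_0[OF int assms(4) assms(5) sum max]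
  have "weak_conv_m (\<lambda>n. distr M borel (\<lambda>\<omega>. \<Sum>k<m n. c n (Suc k) * \<xi> (int (Suc k)) \<omega>))
           std_normal_distribution"
  proof (rule martingale_array_clt[where G = "\<lambda>n k. F (int k)"])
    show "filtered_prob_space M (\<lambda>k. F (int k))" ..
    show "(\<lambda>\<omega>. c n (Suc k) * \<xi> (int (Suc k)) \<omega>) \<in> borel_measurable (F (int (Suc k)))" for n k
      using meas by (intro borel_measurable_times) auto
    show "integrable M (\<lambda>\<omega>. c n (Suc k) * \<xi> (int (Suc k)) \<omega>)" for n k
      using int by simp
    show "AE \<omega> in M. real_cond_exp M (F (int k)) (\<lambda>\<omega>. c n (Suc k) * \<xi> (int (Suc k)) \<omega>) \<omega> = 0" for n k
    proof -
      interpret S: sigma_finite_subalgebra M "F (int k)"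
        by (rule FN.sigma_finite_subalgebra_G)
      show ?thesis
        using S.real_cond_exp_cmult[OF int[of "int (Suc k)"], of "c n (Suc k)"] mds[of "int (Suc k)"]
        by eventually_elim simp
    qed
    show "(\<lambda>n. \<Sum>k<m n. prob {\<omega> \<in> space M. \<eta> < \<bar>c n (Suc k) * \<xi> (int (Suc k)) \<omega>\<bar>}) \<longlonglongrightarrow> 0"
      if "0 < \<eta>" for \<eta>
    proof (rule tendsto_sandwich[OF _ _ tendsto_const])
      \<comment> \<open>The tail estimate covers thresholds up to 1; lowering the threshold only
        enlarges the event.\<close>
      define \<eta>' where "\<eta>' = min \<eta> 1"
      have \<eta>': "0 < \<eta>'" "\<eta>' \<le> 1" "\<eta>' \<le> \<eta>" using that by (auto simp: \<eta>'_def)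
      show "(\<lambda>n. (\<Sum>k<m n. \<bar>c n (Suc k)\<bar> * tail_moment M (\<xi> 0) (\<eta>' / \<bar>c n (Suc k)\<bar>)) / \<eta>') \<longlonglongrightarrow> 0"
        using tendsto_divide[OF lim[OF _ \<eta>'(1,2)] tendsto_const[of \<eta>']] \<eta>' by simp
      show "\<forall>\<^sub>F n in sequentially. (\<Sum>k<m n. prob {\<omega> \<in> space M. \<eta> < \<bar>c n (Suc k) * \<xi> (int (Suc k)) \<omega>\<bar>})
          \<le> (\<Sum>k<m n. \<bar>c n (Suc k)\<bar> * tail_moment M (\<xi> 0) (\<eta>' / \<bar>c n (Suc k)\<bar>)) / \<eta>'"
        unfolding sum_divide_distrib
      proof (intro always_eventually allI sum_mono)
        fix n k
        have [measurable]: "\<And>k. \<xi> k \<in> borel_measurable M"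
          using int by simp
        have "prob {\<omega> \<in> space M. \<eta> < \<bar>c n (Suc k) * \<xi> (int (Suc k)) \<omega>\<bar>}
            \<le> prob {\<omega> \<in> space M. \<eta>' < \<bar>c n (Suc k) * \<xi> (int (Suc k)) \<omega>\<bar>}"
          using \<eta>' by (intro finite_measure_mono) auto
        also have "\<dots> \<le> \<bar>c n (Suc k)\<bar> * tail_moment M (\<xi> 0) (\<eta>' / \<bar>c n (Suc k)\<bar>) / \<eta>'"
          unfolding tail_eq[of "int (Suc k)", symmetric] by (rule prob_cmult_gt_le[OF int \<eta>'(1)])
        finally show "prob {\<omega> \<in> space M. \<eta> < \<bar>c n (Suc k) * \<xi> (int (Suc k)) \<omega>\<bar>}
            \<le> \<bar>c n (Suc k)\<bar> * tail_moment M (\<xi> 0) (\<eta>' / \<bar>c n (Suc k)\<bar>) / \<eta>'" .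
      qed
    qed (auto intro!: always_eventually sum_nonneg)
    \<comment> \<open>The case a = 0 is separate because scaling divides by |a|; both sides are then
      0.\<close>
    have "tail_moment M (\<lambda>\<omega>. a * \<xi> k \<omega>) 1 = \<bar>a\<bar> * tail_moment M (\<xi> 0) (1 / \<bar>a\<bar>)" for a k
      by (cases "a = 0") (simp_all add: tail_moment_cmult tail_eq[of k], simp add: tail_moment_def)
    then show "(\<lambda>n. \<Sum>k<m n. tail_moment M (\<lambda>\<omega>. c n (Suc k) * \<xi> (int (Suc k)) \<omega>) 1) \<longlonglongrightarrow> 0"
      using lim[of 1] by simp
    show "converges_in_probability M (\<lambda>n \<omega>. \<Sum>k<m n. (c n (Suc k) * \<xi> (int (Suc k)) \<omega>)\<^sup>2) 1"
      using assms(9) by (simp add: sum.atLeast1_atMost_eq power_mult_distrib)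
  qed
  then show ?thesis
    by (simp add: sum.atLeast1_atMost_eq)
qed

end
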